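(* The set $\mathcal{U}(\mathbb{U})$ of all universal, ultrahomogeneous $1$-Lipschitz retractions on the Urysohn space $\mathbb{U}$ is a dense $G_\delta$ subset of the space $\mathcal{R}(\mathbb{U})$ of all $1$-Lipschitz retractions on $\mathbb{U}$ equipped with the pointwise retract convergence topology $\tau_{pr}$.
   Context: Urysohn space: $(\mathbb{U},d_{\mathbb{U}})$ is the (unique up to isometry) Polish metric space such that for every finite metric space $X$, every $X_0\subseteq X$ and every isometric embedding $f\colon X_0\to\mathbb{U}$ there is an isometric embedding $\bar f\colon X\to\mathbb{U}$ extending $f$. A $1$-Lipschitz retraction on a metric space $X$ is a $1$-Lipschitz map $R\colon X\to X$ with $R\circ R=R$. $\mathcal{R}(\mathbb{U})$ is the set of all $1$-Lipschitz retractions $R\colon\mathbb{U}\to\mathbb{U}$. For $R\in\mathcal{R}(\mathbb{U})$ put $D_R(x)=\operatorname{dist}(x,R[\mathbb{U}])$. Universal: $U\in\mathcal{R}(\mathbb{U})$ is universal if for every separable metric space $X$ and every $1$-Lipschitz retraction $R\colon X\to X$ there is an isometric embedding $i\colon X\to\mathbb{U}$ such that for every $x\in X$: $i(R(x))=U(i(x))$ and $\operatorname{dist}(x,R[X])=\operatorname{dist}(i(x),U[\mathbb{U}])$. Ultrahomogeneous: $U\in\mathcal{R}(\mathbb{U})$ is ultrahomogeneous if, whenever $A_1,A_2\subseteq\mathbb{U}$ are finite subsets closed under $U$ and $i\colon A_1\to A_2$ is a surjective isometry with $i(U(x))=U(i(x))$ and $\operatorname{dist}(x,U[\mathbb{U}])=\operatorname{dist}(i(x),U[\mathbb{U}])$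 for all $x\in A_1$, then $i$ extends to a surjective isometry $I\colon\mathbb{U}\to\mathbb{U}$ with $I(U(x))=U(I(x))$ and $\operatorname{dist}(x,U[\mathbb{U}])=\operatorname{dist}(I(x),U[\mathbb{U}])$ for all $x\in\mathbb{U}$. $\mathcal{U}(\mathbb{U})=\{U\in\mathcal{R}(\mathbb{U}): U\text{ is universal and ultrahomogeneous}\}$. The topology $\tau_{pr}$ on $\mathcal{R}(\mathbb{U})$ has as basic neighbourhoods of $U\in\mathcal{R}(\mathbb{U})$ the sets $W(U)_{X,\varepsilon}=\{R\in\mathcal{R}(\mathbb{U}): d_{\mathbb{U}}(R(x),U(x))<\varepsilon \text{ and } |D_U(x)-D_R(x)|<\varepsilon\text{ for all }x\in X\}$, for finite $X\subset\mathbb{U}$ and $\varepsilon>0$. *)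

theory Defs
  imports "HOL-Analysis.Analysis"
begin

section \<open>Isometric maps and the Urysohn space\<close>

text \<open>Abstract metric spaces are given by a carrier and a distance (the locale
  \<^locale>\<open>Metric_space\<close>).\<close>

definition isometric_on :: "'a set \<Rightarrow> ('a \<Rightarrow> 'a \<Rightarrow> real) \<Rightarrow> ('a \<Rightarrow> 'b::metric_space) \<Rightarrow> bool"
  where "isometric_on M d f \<longleftrightarrow> (\<forall>x\<in>M. \<forall>y\<in>M. dist (f x) (f y) = d x y)"

text \<open>Completeness and separability come from the class \<^class>\<open>polish_space\<close>. The finite
  metric spaces are taken with carrier a set of natural numbers; every finite metric space is
  isometric to one of these, see \<open>urysohn_space_extension\<close> below.\<close>

definition urysohn_space :: "'u::polish_space itself \<Rightarrow> bool"
  where "urysohn_space _ \<longleftrightarrow>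
    (\<forall>(X :: nat set) d X0 (f :: nat \<Rightarrow> 'u).
       Metric_space X d \<and> finite X \<and> X0 \<subseteq> X \<and> isometric_on X0 d f \<longrightarrow>
       (\<exists>g. isometric_on X d g \<and> (\<forall>x\<in>X0. g x = f x)))"

section \<open>1-Lipschitz retractions\<close>

definition lipschitz_retraction_on :: "'a set \<Rightarrow> ('a \<Rightarrow> 'a \<Rightarrow> real) \<Rightarrow> ('a \<Rightarrow> 'a) \<Rightarrow> bool"
  where "lipschitz_retraction_on M d R \<longleftrightarrow>
    R \<in> M \<rightarrow> M \<and> (\<forall>x\<in>M. \<forall>y\<in>M. d (R x) (R y) \<le> d x y) \<and> (\<forall>x\<in>M. R (R x) = R x)"

definition retractions :: "('u::metric_space \<Rightarrow> 'u) set"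
  where "retractions = {R. lipschitz_retraction_on UNIV dist R}"

text \<open>The distance to the range; \<^const>\<open>infdist\<close> is its counterpart on a metric type.\<close>

definition range_dist_on :: "'a set \<Rightarrow> ('a \<Rightarrow> 'a \<Rightarrow> real) \<Rightarrow> ('a \<Rightarrow> 'a) \<Rightarrow> 'a \<Rightarrow> real"
  where "range_dist_on M d R x = (INF y\<in>R ` M. d x y)"

definition range_dist :: "('u::metric_space \<Rightarrow> 'u) \<Rightarrow> 'u \<Rightarrow> real"
  where "range_dist R x = infdist x (range R)"

text \<open>A separable metric space has at most continuum many points, so up to isometry all
  separable metric spaces have a set of reals as carrier (with an arbitrary metric unrelated to
  the one of the real line); see \<open>universal_retraction_embedding\<close> below.\<close>

definition universal_retraction :: "('u::metric_space \<Rightarrow> 'u) \<Rightarrow> bool"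
  where "universal_retraction U \<longleftrightarrow>
    (\<forall>(X :: real set) d R.
       Metric_space X d \<and> separable_space (Metric_space.mtopology X d) \<and>
       lipschitz_retraction_on X d R \<longrightarrow>
       (\<exists>i. isometric_on X d i \<and>
            (\<forall>x\<in>X. i (R x) = U (i x) \<and> range_dist_on X d R x = range_dist U (i x))))"

definition ultrahomogeneous_retraction :: "('u::metric_space \<Rightarrow> 'u) \<Rightarrow> bool"
  where "ultrahomogeneous_retraction U \<longleftrightarrow>
    (\<forall>A1 A2 i.
       finite A1 \<and> finite A2 \<and> U ` A1 \<subseteq> A1 \<and> U ` A2 \<subseteq> A2 \<and>
       i ` A1 = A2 \<and> isometric_on A1 dist i \<and>
       (\<forall>x\<in>A1. i (U x) = U (i x) \<and> range_dist U x = range_dist U (i x)) \<longrightarrow>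
       (\<exists>I. surj I \<and> isometric_on UNIV dist I \<and> (\<forall>x\<in>A1. I x = i x) \<and>
            (\<forall>x. I (U x) = U (I x) \<and> range_dist U x = range_dist U (I x))))"

definition universal_ultrahomogeneous_retractions :: "('u::metric_space \<Rightarrow> 'u) set"
  where "universal_ultrahomogeneous_retractions =
    {U \<in> retractions. universal_retraction U \<and> ultrahomogeneous_retraction U}"

section \<open>The pointwise retract convergence topology\<close>

definition pr_nhd :: "('u::metric_space \<Rightarrow> 'u) \<Rightarrow> 'u set \<Rightarrow> real \<Rightarrow> ('u \<Rightarrow> 'u) set"
  where "pr_nhd U X e =
    {R \<in> retractions. \<forall>x\<in>X. dist (R x) (U x) < e \<and> \<bar>range_dist U x - range_dist R x\<bar> < e}"

definition pr_topology :: "('u::metric_space \<Rightarrow> 'u) topology"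
  where "pr_topology = topology (\<lambda>S. S \<subseteq> retractions \<and>
    (\<forall>U\<in>S. \<exists>X e. finite X \<and> e > 0 \<and> pr_nhd U X e \<subseteq> S))"

lemma openin_pr_topology:
  fixes S :: "('u::metric_space \<Rightarrow> 'u) set"
  shows "openin pr_topology S \<longleftrightarrow>
     S \<subseteq> retractions \<and> (\<forall>U\<in>S. \<exists>X e. finite X \<and> e > 0 \<and> pr_nhd U X e \<subseteq> S)"
proof -
  have "istopology (\<lambda>S :: ('u \<Rightarrow> 'u) set. S \<subseteq> retractions \<and>
    (\<forall>U\<in>S. \<exists>X e. finite X \<and> e > 0 \<and> pr_nhd U X e \<subseteq> S))" (is "istopology ?P")
    unfolding istopology_def
  proof (intro conjI allI impI)
    fix S T :: "('u \<Rightarrow> 'u) set"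
    assume S: "?P S" and T: "?P T"
    show "S \<inter> T \<subseteq> retractions" using S by blast
    show "\<forall>U\<in>S \<inter> T. \<exists>X e. finite X \<and> e > 0 \<and> pr_nhd U X e \<subseteq> S \<inter> T"
    proof
      fix U assume U: "U \<in> S \<inter> T"
      obtain X e where 1: "finite X" "e > 0" "pr_nhd U X e \<subseteq> S" using S U by blast
      obtain Y e' where 2: "finite Y" "e' > 0" "pr_nhd U Y e' \<subseteq> T" using T U by blast
      have "pr_nhd U (X \<union> Y) (min e e') \<subseteq> pr_nhd U X e \<inter> pr_nhd U Y e'"
        by (auto simp: pr_nhd_def)
      with 1 2 show "\<exists>X e. finite X \<and> e > 0 \<and> pr_nhd U X e \<subseteq> S \<inter> T"
        by (intro exI[of _ "X \<union> Y"] exI[of _ "min e e'"]) auto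
    qed
  next
    fix K :: "('u \<Rightarrow> 'u) set set"
    assume K: "\<forall>S\<in>K. ?P S"
    show "\<Union>K \<subseteq> retractions" using K by blast
    show "\<forall>U\<in>\<Union>K. \<exists>X e. finite X \<and> e > 0 \<and> pr_nhd U X e \<subseteq> \<Union>K"
    proof
      fix U assume "U \<in> \<Union>K"
      then obtain S where S: "S \<in> K" "U \<in> S" by blast
      then obtain X e where "finite X" "e > 0" "pr_nhd U X e \<subseteq> S" using K by blast
      with S show "\<exists>X e. finite X \<and> e > 0 \<and> pr_nhd U X e \<subseteq> \<Union>K" by blast
    qed
  qed
  then show ?thesis unfolding pr_topology_def by (subst topology_inverse') auto
qed

lemma topspace_pr_topology: "topspace pr_topology = retractions"
proof -
  have "openin pr_topology retractions"
    unfolding openin_pr_topology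
    by (auto simp: pr_nhd_def intro!: exI[of _ "{}"] exI[of _ "1::real"])
  then show ?thesis
    by (metis openin_pr_topology openin_subset openin_topspace subset_antisym)
qed

lemma openin_pr_nhd:
  assumes "finite X"
  shows "openin pr_topology (pr_nhd U X e)"
  unfolding openin_pr_topology
proof (intro conjI ballI)
  show "pr_nhd U X e \<subseteq> retractions" by (auto simp: pr_nhd_def)
  fix V assume V: "V \<in> pr_nhd U X e"
  define m where "m x = max (dist (V x) (U x)) \<bar>range_dist U x - range_dist V x\<bar>" for x
  define r where "r = Min (insert 1 ((\<lambda>x. e - m x) ` X))"
  have fin: "finite (insert 1 ((\<lambda>x. e - m x) ` X))" using assms by simp
  have r: "r > 0"
    using V fin by (auto simp: r_def m_def pr_nhd_def)
  have rle: "r \<le> e - m x" if "x \<in> X" for x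
    using fin that unfolding r_def by (intro Min_le) auto
  have "pr_nhd V X r \<subseteq> pr_nhd U X e"
  proof
    fix R assume R: "R \<in> pr_nhd V X r"
    have "dist (R x) (U x) < e \<and> \<bar>range_dist U x - range_dist R x\<bar> < e" if "x \<in> X" for x
    proof -
      have "dist (R x) (V x) < r" "\<bar>range_dist V x - range_dist R x\<bar> < r"
        using R that by (auto simp: pr_nhd_def)
      moreover have "dist (V x) (U x) \<le> m x" "\<bar>range_dist U x - range_dist V x\<bar> \<le> m x"
        by (auto simp: m_def)
      ultimately show ?thesis
        using rle[OF that] dist_triangle[of "R x" "U x" "V x"] by linarith
    qed
    with R show "R \<in> pr_nhd U X e" by (auto simp: pr_nhd_def)
  qed
  with r assms show "\<exists>Y e'. finite Y \<and> e' > 0 \<and> pr_nhd V Y e' \<subseteq> pr_nhd U X e" by blast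
qed

section \<open>Independence of the carrier types\<close>

lemma Metric_space_transport:
  assumes "Metric_space X d" "inj_on h X"
  shows "Metric_space (h ` X) (\<lambda>a b. d (inv_into X h a) (inv_into X h b))"
proof -
  interpret Metric_space X d by fact
  show ?thesis
    using assms(2) by unfold_locales (auto simp: commute triangle)
qed

theorem urysohn_space_extension:
  fixes f :: "'a \<Rightarrow> 'u::polish_space"
  assumes "urysohn_space TYPE('u)" "Metric_space X d" "finite X" "X0 \<subseteq> X" "isometric_on X0 d f"
  obtains g where "isometric_on X d g" "\<And>x. x \<in> X0 \<Longrightarrow> g x = f x"
proof -
  obtain h :: "'a \<Rightarrow> nat" where h: "inj_on h X"
    using assms(3) finite_imp_inj_to_nat_seg by blast
  let ?k = "inv_into X h"
  let ?d = "\<lambda>a b. d (?k a) (?k b)"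
  have kh: "?k (h x) = x" if "x \<in> X" for x using h that by simp
  have "Metric_space (h ` X) ?d" by (rule Metric_space_transport[OF assms(2) h])
  moreover have "isometric_on (h ` X0) ?d (f \<circ> ?k)"
    using assms(4,5) kh by (auto simp: isometric_on_def subset_iff)
  ultimately have "Metric_space (h ` X) ?d \<and> finite (h ` X) \<and> h ` X0 \<subseteq> h ` X \<and>
      isometric_on (h ` X0) ?d (f \<circ> ?k)"
    using assms(3,4) by (simp add: image_mono)
  then have "\<exists>g. isometric_on (h ` X) ?d g \<and> (\<forall>x\<in>h ` X0. g x = (f \<circ> ?k) x)"
    by (rule assms(1)[unfolded urysohn_space_def, rule_format])
  then obtain g where g: "isometric_on (h ` X) ?d g" "\<forall>x\<in>h ` X0. g x = (f \<circ> ?k) x"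
    by (elim exE conjE)
  show thesis
  proof
    show "isometric_on X d (g \<circ> h)" using g(1) kh by (auto simp: isometric_on_def)
    fix x assume x: "x \<in> X0"
    then have "g (h x) = f (?k (h x))" using g(2) by simp
    moreover have "?k (h x) = x" using kh x assms(4) by blast
    ultimately show "(g \<circ> h) x = f x" by simp
  qed
qed

lemma separable_metric_inj_real:
  fixes X :: "'a set"
  assumes "Metric_space X d" "separable_space (Metric_space.mtopology X d)"
  obtains h :: "'a \<Rightarrow> real" where "inj_on h X"
proof -
  interpret Metric_space X d by fact
  obtain C where C: "countable C" "C \<subseteq> X" "mtopology closure_of C = X"
    using assms(2) by (auto simp: separable_space_def)
  define D where "D x = {(c, n :: nat). c \<in> C \<and> d c x < inverse (real (Suc n))}" for x
  have inj: "inj_on D X"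
  proof (rule inj_onI, rule ccontr)
    fix x y assume xy: "x \<in> X" "y \<in> X" "D x = D y" "x \<noteq> y"
    then have "d x y > 0" by (simp only: mdist_pos_less not_False_eq_True)
    then obtain n where n: "inverse (real (Suc n)) < d x y / 2"
      using reals_Archimedean[of "d x y / 2"] by (metis half_gt_zero)
    have "x \<in> mtopology closure_of C" using C xy by simp
    then obtain c where c: "c \<in> C" "d x c < inverse (real (Suc n))"
      unfolding metric_closure_of mem_Collect_eq in_mball
      by (metis inverse_positive_iff_positive of_nat_0_less_iff zero_less_Suc)
    then have "(c, n) \<in> D x" unfolding D_def by (simp add: commute del: of_nat_Suc)
    then have "(c, n) \<in> D y" using xy(3) by simp
    then have "d c y < inverse (real (Suc n))" unfolding D_def by (simp del: of_nat_Suc)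
    moreover have "d x y \<le> d x c + d c y"
      using c(1) C(2) xy(1,2) by (intro triangle) auto
    ultimately show False using c(2) n by linarith
  qed
  have cnt: "countable (C \<times> (UNIV :: nat set))" using C(1) by simp
  define e where "e = to_nat_on (C \<times> (UNIV :: nat set))"
  have "inj_on e (C \<times> UNIV)" unfolding e_def by (rule inj_on_to_nat_on[OF cnt])
  moreover have "D x \<subseteq> C \<times> UNIV" for x by (auto simp: D_def)
  ultimately have "e ` D x = e ` D y \<longleftrightarrow> D x = D y" for x y
    by (intro inj_on_image_eq_iff)
  then have inj2: "inj_on (\<lambda>x. e ` D x) X"
    using inj unfolding inj_on_def by simp
  obtain r :: "nat set \<Rightarrow> real" where r: "inj r"
    using eqpoll_imp_lepoll[OF nat_sets_eqpoll_reals] unfolding lepoll_def by blast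
  have "inj_on (\<lambda>x. r (e ` D x)) X"
    using inj2 r by (simp add: inj_on_def)
  then show thesis by (rule that)
qed

theorem universal_retraction_embedding:
  fixes X :: "'a set" and U :: "'u::metric_space \<Rightarrow> 'u"
  assumes "universal_retraction U" "Metric_space X d"
    "separable_space (Metric_space.mtopology X d)" "lipschitz_retraction_on X d R"
  obtains i where "isometric_on X d i" "\<And>x. x \<in> X \<Longrightarrow> i (R x) = U (i x)"
    "\<And>x. x \<in> X \<Longrightarrow> range_dist_on X d R x = range_dist U (i x)"
proof -
  interpret X: Metric_space X d by fact
  obtain h :: "'a \<Rightarrow> real" where h: "inj_on h X"
    using separable_metric_inj_real[OF assms(2,3)] .
  let ?k = "inv_into X h"
  let ?d = "\<lambda>a b. d (?k a) (?k b)"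
  let ?R = "h \<circ> R \<circ> ?k"
  have kh: "?k (h x) = x" if "x \<in> X" for x using h that by simp
  have RX: "R x \<in> X" if "x \<in> X" for x
    using assms(4) that by (auto simp: lipschitz_retraction_on_def)
  interpret Y: Metric_space "h ` X" ?d by (rule Metric_space_transport[OF assms(2) h])
  have cont: "continuous_map X.mtopology Y.mtopology h"
    unfolding Metric_space.metric_continuous_map[OF assms(2) Y.Metric_space_axioms]
    using kh by auto
  have "separable_space Y.mtopology"
    by (rule separable_space_continuous_map_image[OF assms(3) cont]) simp
  moreover have "lipschitz_retraction_on (h ` X) ?d ?R"
    using assms(4) kh RX by (auto simp: lipschitz_retraction_on_def)
  ultimately have "Metric_space (h ` X) ?d \<and> separable_space Y.mtopology \<and>
      lipschitz_retraction_on (h ` X) ?d ?R"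
    using Y.Metric_space_axioms by simp
  then have "\<exists>i. isometric_on (h ` X) ?d i \<and> (\<forall>y\<in>h ` X. i (?R y) = U (i y) \<and>
      range_dist_on (h ` X) ?d ?R y = range_dist U (i y))"
    by (rule assms(1)[unfolded universal_retraction_def, rule_format])
  then obtain i where i: "isometric_on (h ` X) ?d i"
    "\<forall>y\<in>h ` X. i (?R y) = U (i y) \<and> range_dist_on (h ` X) ?d ?R y = range_dist U (i y)"
    by (elim exE conjE)
  show thesis
  proof
    show "isometric_on X d (i \<circ> h)" using i(1) kh by (auto simp: isometric_on_def)
    fix x assume x: "x \<in> X"
    show "(i \<circ> h) (R x) = U ((i \<circ> h) x)" using bspec[OF i(2) imageI[OF x]] kh[OF x] by simp
    have "range_dist_on (h ` X) ?d ?R (h x) = range_dist_on X d R x"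
      unfolding range_dist_on_def image_image using x kh RX by (intro INF_cong) auto
    then show "range_dist_on X d R x = range_dist U ((i \<circ> h) x)"
      using bspec[OF i(2) imageI[OF x]] by simp
  qed
qed

end

theory Submission
  imports Defs
begin

text \<open>A retraction \<open>R\<close> is studied together with \<open>D\<close>, the distance to its range. Finite metric
  spaces carrying such a pair amalgamate, and a retraction \<open>U\<close> of the Urysohn space is universal and
  ultrahomogeneous iff every one-point extension of a finite part of \<open>U\<close> is realised by a point of
  the space: one direction is a back-and-forth argument, the other embeds the whole space into itself
  twice, through a fixed retraction that realises everything, and pulls the result back by
  ultrahomogeneity.

  By completeness it suffices to realise approximately the extension data with rational values over a
  countable dense set, since an approximate realisation can be added to the data and improved. Each of
  these countably many requirements is an open condition on \<open>U\<close>, which gives the \<open>G\<^sub>\<delta>\<close> property.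

  For density, the restriction of any retraction to a finite set closed under it is enlarged inside the
  Urysohn space by finite steps that exhaust the dense set and realise all extension data. The
  completion of the union realises everything and agrees on the finite set with the given
  retraction, including the distance to the range.\<close>

text \<open>\<open>D\<close> is part of the structure because \<open>R\<close> on a finite set does
  not determine it: points nearly attaining it may lie outside. It becomes the true distance to the
  range only in the limit, once enough fixed points have been added.

  Exact distances would have to satisfy two-sided inequalities, which rounding can destroy. Hence
  data consist of upper bounds, and the distances to be realised are those of the largest function
  below the bounds. Admissibility is then a finite list of non-strict inequalities, which gain room
  when the bounds are enlarged. "Admissible data are approximately realised" is an implication from
  a closed to an open condition, and therefore open.

  The image of a point has to be present before the point. This leaves two kinds of data: a new
  fixed point, or a new point whose image already exists. That image is named \<open>U b\<close>
  with \<open>b\<close> in the dense set, not as a point of the range: the range varies with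
  \<open>U\<close>, while the parameters must be countable and common to all
  \<open>U\<close>.\<close>

section \<open>Distance functions generated by finitely many prescribed values\<close>

text \<open>The largest 1-Lipschitz function whose value at \<open>c\<close> is at most \<open>s\<close> for all \<open>(c, s) \<in> P\<close>. The
  values are only upper bounds, so the conditions below are stable under enlarging them. Junk for \<open>P = {}\<close>.\<close>

definition kat :: "('u::metric_space \<times> real) set \<Rightarrow> 'u \<Rightarrow> real"
  where "kat P x = Min ((\<lambda>(c, s). s + dist c x) ` P)"

definition katetov :: "('u::metric_space \<times> real) set \<Rightarrow> bool"
  where "katetov P \<longleftrightarrow> (\<forall>(c, s)\<in>P. \<forall>(c', s')\<in>P. dist c c' \<le> s + s')"

lemma katetovD: "katetov P \<Longrightarrow> (c, s) \<in> P \<Longrightarrow> (c', s') \<in> P \<Longrightarrow> dist c c' \<le> s + s'"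
  by (auto simp: katetov_def)

lemma kat_le: "finite P \<Longrightarrow> (c, s) \<in> P \<Longrightarrow> kat P x \<le> s + dist c x"
  unfolding kat_def by (intro Min_le) force+

lemma kat_attained:
  assumes "finite P" "P \<noteq> {}"
  obtains c s where "(c, s) \<in> P" "kat P x = s + dist c x"
proof -
  have "kat P x \<in> (\<lambda>(c, s). s + dist c x) ` P"
    unfolding kat_def using assms by (intro Min_in) auto
  then show thesis using that by auto
qed

lemma kat_eqI:
  assumes "finite P" "(x, s) \<in> P" "\<And>c t. (c, t) \<in> P \<Longrightarrow> s \<le> t + dist c x"
  shows "kat P x = s"
proof -
  obtain c t where "(c, t) \<in> P" "kat P x = t + dist c x"
    using kat_attained[of P x] assms by blast
  with assms kat_le[of P x s x] show ?thesis by fastforce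
qed

lemma kat_lipschitz:
  assumes "finite P" "P \<noteq> {}"
  shows "kat P x \<le> kat P y + dist x y"
proof -
  obtain c s where "(c, s) \<in> P" "kat P y = s + dist c y"
    using kat_attained[OF assms] .
  with kat_le[OF assms(1), of c s x] dist_triangle[of c x y] show ?thesis
    by (simp add: dist_commute)
qed

text \<open>With \<open>kat_lipschitz\<close> this makes \<open>kat P\<close> a Katetov function,
  that is, the distance function of a point in some one-point extension. The values at
  \<open>x\<close> and \<open>y\<close> are attained at two centres, which \<open>katetov P\<close>
  compares.\<close>

lemma dist_le_kat:
  assumes "finite P" "P \<noteq> {}" "katetov P"
  shows "dist x y \<le> kat P x + kat P y"
proof -
  obtain c s where c: "(c, s) \<in> P" "kat P x = s + dist c x"
    using kat_attained[OF assms(1,2)] .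
  obtain c' s' where c': "(c', s') \<in> P" "kat P y = s' + dist c' y"
    using kat_attained[OF assms(1,2)] .
  have "dist x y \<le> dist c x + dist c c' + dist c' y"
    using dist_triangle[of x y c] dist_triangle[of c y c'] by (simp add: dist_commute)
  with katetovD[OF assms(3) c(1) c'(1)] c c' show ?thesis by linarith
qed

lemma kat_isometric_image:
  assumes "\<And>c s. (c, s) \<in> P \<Longrightarrow> dist (h c) (h x) = dist c x"
  shows "kat (map_prod h id ` P) (h x) = kat P x"
proof -
  have "(\<lambda>(c, s). s + dist c (h x)) ` map_prod h id ` P = (\<lambda>(c, s). s + dist c x) ` P"
    unfolding image_image using assms by (intro image_cong) auto
  then show ?thesis unfolding kat_def by simp
qed

text \<open>The triangle inequality through \<open>c\<close> carries the loss
  \<open>\<kappa>\<close> over to every \<open>x\<close>. Applied in both directions it shows that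
  rounding the data hardly changes the generated function.\<close>

lemma kat_le_perturb:
  assumes "finite P" "P \<noteq> {}" "finite Q"
    and "\<And>c s. (c, s) \<in> P \<Longrightarrow> \<exists>(c', s')\<in>Q. s' + dist c' c \<le> s + \<kappa>"
  shows "kat Q x \<le> kat P x + \<kappa>"
proof -
  obtain c s where c: "(c, s) \<in> P" "kat P x = s + dist c x"
    using kat_attained[OF assms(1,2)] .
  then obtain c' s' where c': "(c', s') \<in> Q" "s' + dist c' c \<le> s + \<kappa>"
    using assms(4) by blast
  show ?thesis
    using kat_le[OF assms(3) c'(1), of x] c' c(2) dist_triangle[of c' x c] by linarith
qed

lemma kat_insert:
  "finite P \<Longrightarrow> P \<noteq> {} \<Longrightarrow> kat (insert (c, s) P) x = min (s + dist c x) (kat P x)"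
  by (simp add: kat_def)

text \<open>An abstract point is adjoined to \<open>A\<close> at the distances \<open>f\<close>. A
  zero of \<open>f\<close> is treated apart, since the new point would then be at distance 0 from an
  old one; that old point already has the required distances.\<close>

lemma urysohn_realises:
  fixes f :: "'u::polish_space \<Rightarrow> real"
  assumes "urysohn_space TYPE('u)" "finite A"
    and lip: "\<And>x y. x \<in> A \<Longrightarrow> y \<in> A \<Longrightarrow> f x \<le> f y + dist x y"
    and tri: "\<And>x y. x \<in> A \<Longrightarrow> y \<in> A \<Longrightarrow> dist x y \<le> f x + f y"
  obtains y where "\<And>a. a \<in> A \<Longrightarrow> dist y a = f a"
proof (cases "\<exists>a\<in>A. f a = 0")
  case True
  then obtain a where a: "a \<in> A" "f a = 0" by blast
  have "dist a b = f b" if "b \<in> A" for b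
    using lip[OF that a(1)] tri[OF a(1) that] a by (simp add: dist_commute)
  then show thesis by (rule that)
next
  case False
  have nn: "f a > 0" if "a \<in> A" for a using tri[OF that that] False that by force
  have lip1: "f x \<le> dist x y + f y" and lip2: "f x \<le> f y + dist y x" if "x \<in> A" "y \<in> A" for x y
    using lip[OF that] by (auto simp: dist_commute add.commute)
  define d where "d p q = (case (p, q) of (None, None) \<Rightarrow> 0 | (Some x, None) \<Rightarrow> f x
    | (None, Some y) \<Rightarrow> f y | (Some x, Some y) \<Rightarrow> dist x y)" for p q
  let ?X = "insert None (Some ` A)"
  \<comment> \<open>\<open>Metric_space\<close> asks for nonnegativity also off the carrier, where
    nothing is known about \<open>f\<close>; hence the cut to 0.\<close>
  have "Metric_space ?X (\<lambda>p q. if p \<in> ?X \<and> q \<in> ?X then d p q else 0)"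
  proof
    fix p q
    show "0 \<le> (if p \<in> ?X \<and> q \<in> ?X then d p q else 0)"
      using nn by (auto simp: d_def less_imp_le split: option.splits)
    show "(if p \<in> ?X \<and> q \<in> ?X then d p q else 0) = (if q \<in> ?X \<and> p \<in> ?X then d q p else 0)"
      by (auto simp: d_def dist_commute split: option.splits)
    assume "p \<in> ?X" "q \<in> ?X"
    then show "((if p \<in> ?X \<and> q \<in> ?X then d p q else 0) = 0) = (p = q)"
      using nn by (force simp: d_def split: option.splits)
  next
    fix p q r
    assume "p \<in> ?X" "q \<in> ?X" "r \<in> ?X"
    then show "(if p \<in> ?X \<and> r \<in> ?X then d p r else 0)
      \<le> (if p \<in> ?X \<and> q \<in> ?X then d p q else 0) + (if q \<in> ?X \<and> r \<in> ?X then d q r else 0)"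
      using lip1 lip2 tri dist_triangle
      by (auto simp: d_def less_imp_le[OF nn] split: option.splits)
  qed
  moreover have "isometric_on (Some ` A) (\<lambda>p q. if p \<in> ?X \<and> q \<in> ?X then d p q else 0) the"
    by (auto simp: isometric_on_def d_def)
  ultimately obtain g where g: "isometric_on ?X (\<lambda>p q. if p \<in> ?X \<and> q \<in> ?X then d p q else 0) g"
    "\<And>x. x \<in> Some ` A \<Longrightarrow> g x = the x"
    using urysohn_space_extension[OF assms(1), of ?X _ "Some ` A" the] assms(2) by blast
  have "dist (g None) a = f a" if "a \<in> A" for a
  proof -
    have "dist (g None) (g (Some a)) = d None (Some a)"
      using g(1) that by (auto simp: isometric_on_def)
    then show ?thesis using g(2) that by (simp add: d_def)
  qed
  then show thesis by (rule that)
qed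

section \<open>Retraction structures\<close>

text \<open>If \<open>p = R p\<close>, then \<open>d x (R x) \<le> d x p + d (R p) (R x) \<le> 2 * d x p\<close>, which is the reason for
  the last assumption when \<open>D\<close> is the distance to the range. Finite structures need not attain
  \<open>D\<close> by their own points.\<close>

locale retraction_structure = Metric_space M d for M :: "'a set" and d +
  fixes R :: "'a \<Rightarrow> 'a" and D :: "'a \<Rightarrow> real"
  assumes R_in: "x \<in> M \<Longrightarrow> R x \<in> M"
    and R_lip: "x \<in> M \<Longrightarrow> y \<in> M \<Longrightarrow> d (R x) (R y) \<le> d x y"
    and R_idem: "x \<in> M \<Longrightarrow> R (R x) = R x"
    and D_lip: "x \<in> M \<Longrightarrow> y \<in> M \<Longrightarrow> D x \<le> D y + d x y"
    and D_R: "x \<in> M \<Longrightarrow> D (R x) = 0"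
    and dist_R: "x \<in> M \<Longrightarrow> d x (R x) \<le> 2 * D x"

lemma retraction_structure_subset:
  assumes "retraction_structure M d R D" "A \<subseteq> M" "R ` A \<subseteq> A"
  shows "retraction_structure A d R D"
proof -
  interpret retraction_structure M d R D by fact
  interpret A: Metric_space A d by (rule subspace) fact
  show ?thesis
    using assms(2,3) R_lip R_idem D_lip D_R dist_R by unfold_locales (auto simp: subset_iff)
qed

lemma retraction_structure_range_dist_on:
  assumes "Metric_space X d" "lipschitz_retraction_on X d R"
  shows "retraction_structure X d R (range_dist_on X d R)"
proof -
  interpret Metric_space X d by fact
  note R = assms(2)[unfolded lipschitz_retraction_on_def]
  have RX: "R x \<in> X" if "x \<in> X" for x using R that by auto
  have bdd: "bdd_below (d x ` R ` X)" for x by (rule bdd_belowI[of _ 0]) auto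
  have le: "range_dist_on X d R x \<le> d x (R z)" if "z \<in> X" for x z
    unfolding range_dist_on_def using that bdd by (intro cINF_lower) auto
  have ge: "b \<le> range_dist_on X d R x"
    if "x \<in> X" "\<And>z. z \<in> X \<Longrightarrow> b \<le> d x (R z)" for b x
    unfolding range_dist_on_def using that by (intro cINF_greatest) auto
  show ?thesis
  proof
    fix x y assume x: "x \<in> X" and y: "y \<in> X"
    show "R x \<in> X" "R (R x) = R x" "d (R x) (R y) \<le> d x y" using R x y by auto
    have "range_dist_on X d R x - d x y \<le> range_dist_on X d R y"
    proof (rule ge[OF y])
      fix z assume z: "z \<in> X"
      show "range_dist_on X d R x - d x y \<le> d y (R z)"
        using le[OF z, of x] triangle[OF x y RX[OF z]] by linarith
    qed
    then show "range_dist_on X d R x \<le> range_dist_on X d R y + d x y" by linarith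
    have "range_dist_on X d R (R x) \<le> 0" using le[OF x, of "R x"] RX[OF x] by simp
    moreover have "0 \<le> range_dist_on X d R (R x)" by (rule ge) (auto intro: RX x)
    ultimately show "range_dist_on X d R (R x) = 0" by linarith
    have "d x (R x) / 2 \<le> range_dist_on X d R x"
    proof (rule ge[OF x])
      fix z assume z: "z \<in> X"
      have "d (R (R z)) (R x) \<le> d (R z) x" using R RX[OF z] x by blast
      then have "d (R z) (R x) \<le> d (R z) x" using R z by simp
      then show "d x (R x) / 2 \<le> d x (R z)"
        using triangle[OF x RX[OF z] RX[OF x]] commute[of x "R z"] by linarith
    qed
    then show "d x (R x) \<le> 2 * range_dist_on X d R x" by linarith
  qed
qed

lemma range_dist_on_UNIV: "range_dist_on UNIV dist U = range_dist U"
  by (auto simp: range_dist_on_def range_dist_def infdist_def)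

lemma Metric_space_dist: "Metric_space A dist"
  by (rule Met_TC.subspace) simp

lemma retraction_structure_UNIV:
  assumes "U \<in> retractions"
  shows "retraction_structure UNIV dist U (range_dist U)"
  using retraction_structure_range_dist_on[OF Metric_space_dist, of UNIV U] assms
  by (simp add: range_dist_on_UNIV retractions_def)

lemma retraction_structure_insert_fixed:
  assumes "retraction_structure A dist R D" "p \<notin> A"
    and "\<And>a. a \<in> A \<Longrightarrow> dist p (R a) \<le> dist p a" "\<And>a. a \<in> A \<Longrightarrow> D a \<le> dist p a"
  shows "retraction_structure (insert p A) dist (R(p := p)) (D(p := 0))"
proof -
  interpret retraction_structure A dist R D by fact
  interpret I: Metric_space "insert p A" dist by (rule Metric_space_dist)
  have Rp: "dist (R a) p \<le> dist a p" and Dp: "D a \<le> dist a p" if "a \<in> A" for a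
    using assms(3,4)[OF that] by (simp_all add: dist_commute)
  have nn: "0 \<le> D a" if "a \<in> A" for a using dist_R[OF that] zero_le_dist[of a "R a"] by linarith
  have ne: "R a \<noteq> p" if "a \<in> A" for a using R_in[OF that] assms(2) by auto
  show ?thesis
  proof
    fix x y assume xy: "x \<in> insert p A" "y \<in> insert p A"
    then show "dist ((R(p := p)) x) ((R(p := p)) y) \<le> dist x y"
      using R_lip assms(3) Rp by auto
    show "(D(p := 0)) x \<le> (D(p := 0)) y + dist x y"
      using xy D_lip Dp nn by auto
  next
    fix x assume "x \<in> insert p A"
    then show "(R(p := p)) x \<in> insert p A" "(R(p := p)) ((R(p := p)) x) = (R(p := p)) x"
      "(D(p := 0)) ((R(p := p)) x) = 0" "dist x ((R(p := p)) x) \<le> 2 * (D(p := 0)) x"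
      using R_in R_idem D_R dist_R ne by auto
  qed
qed

lemma retraction_structure_insert_moved:
  assumes "retraction_structure A dist R D" "q \<notin> A" "r \<in> A" "R r = r"
    and "\<And>a. a \<in> A \<Longrightarrow> dist r (R a) \<le> dist q a" "\<And>a. a \<in> A \<Longrightarrow> \<bar>\<delta> - D a\<bar> \<le> dist q a"
    and "dist q r \<le> 2 * \<delta>"
  shows "retraction_structure (insert q A) dist (R(q := r)) (D(q := \<delta>))"
proof -
  interpret retraction_structure A dist R D by fact
  interpret I: Metric_space "insert q A" dist by (rule Metric_space_dist)
  have ne: "R a \<noteq> q" if "a \<in> A" for a using R_in[OF that] assms(2) by auto
  have \<delta>: "\<delta> \<le> D a + dist q a" "D a \<le> \<delta> + dist a q" if "a \<in> A" for a
    using assms(6)[OF that] by (auto simp: dist_commute)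
  have Rr: "dist (R a) r \<le> dist a q" if "a \<in> A" for a
    using assms(5)[OF that] by (simp add: dist_commute)
  have r: "D r = 0" "r \<noteq> q" using D_R[OF assms(3)] assms(2-4) by auto
  show ?thesis
  proof
    fix x y assume "x \<in> insert q A" "y \<in> insert q A"
    then show "dist ((R(q := r)) x) ((R(q := r)) y) \<le> dist x y"
      using R_lip assms(5) Rr by auto
    show "(D(q := \<delta>)) x \<le> (D(q := \<delta>)) y + dist x y"
      using D_lip \<delta> \<open>x \<in> insert q A\<close> \<open>y \<in> insert q A\<close> by auto
  next
    fix x assume "x \<in> insert q A"
    then show "(R(q := r)) x \<in> insert q A" "(R(q := r)) ((R(q := r)) x) = (R(q := r)) x"
      "(D(q := \<delta>)) ((R(q := r)) x) = 0" "dist x ((R(q := r)) x) \<le> 2 * (D(q := \<delta>)) x"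
      using assms(3,4,7) r R_in[of x] R_idem[of x] D_R[of x] dist_R[of x] ne[of x]
      by (cases "x = q"; simp)+
  qed
qed

section \<open>The extension property\<close>

text \<open>Data for a new point \<open>y\<close> with prescribed bounds on \<open>dist y c\<close>. If \<open>y\<close> is fixed by \<open>R\<close>, a bound for
  the distance to \<open>c\<close> is also one for the distance to \<open>R c\<close>. If \<open>R y = R b\<close> and \<open>D y = \<delta>\<close>,
  then \<open>2 * \<delta>\<close> bounds \<open>dist y (R b)\<close>.\<close>

definition saturate :: "('u \<Rightarrow> 'u) \<Rightarrow> ('u \<times> real) set \<Rightarrow> ('u \<times> real) set"
  where "saturate R P = P \<union> map_prod R id ` P"

definition fixed_data :: "('u::metric_space \<Rightarrow> 'u) \<Rightarrow> ('u \<Rightarrow> real) \<Rightarrow> ('u \<times> real) set \<Rightarrow> bool"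
  where "fixed_data R D P \<longleftrightarrow> katetov (saturate R P) \<and> (\<forall>(c, s)\<in>P. D c \<le> s)"

definition moved_data ::
    "('u::metric_space \<Rightarrow> 'u) \<Rightarrow> ('u \<Rightarrow> real) \<Rightarrow> ('u \<times> real) set \<Rightarrow> 'u \<Rightarrow> real \<Rightarrow> bool"
  where "moved_data R D P b \<delta> \<longleftrightarrow> katetov (insert (R b, 2 * \<delta>) P) \<and>
    (\<forall>(c, s)\<in>P. dist (R b) (R c) \<le> s \<and> \<bar>\<delta> - D c\<bar> \<le> s)"

text \<open>Admissibility is a premise inside the definition, so that all data can be listed before
  the retraction is known: data that turn out to be inadmissible are realised for free.\<close>

definition fixed_realised :: "'u set \<Rightarrow> ('u::metric_space \<Rightarrow> 'u) \<Rightarrow> ('u \<Rightarrow> real) \<Rightarrow> ('u \<times> real) set \<Rightarrow> bool"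
  where "fixed_realised A R D P \<longleftrightarrow> (fixed_data R D P \<longrightarrow>
    (\<exists>y\<in>A. R y = y \<and> (\<forall>(c, s)\<in>P. dist y c = kat (saturate R P) c)))"

definition moved_realised :: "'u set \<Rightarrow> ('u::metric_space \<Rightarrow> 'u) \<Rightarrow> ('u \<Rightarrow> real) \<Rightarrow> ('u \<times> real) set \<Rightarrow>
    'u \<Rightarrow> real \<Rightarrow> bool"
  where "moved_realised A R D P b \<delta> \<longleftrightarrow> (moved_data R D P b \<delta> \<longrightarrow>
    (\<exists>y\<in>A. R y = R b \<and> D y = \<delta> \<and> (\<forall>(c, s)\<in>P. dist y c = kat (insert (R b, 2 * \<delta>) P) c)))"

definition extension_property :: "('u::metric_space \<Rightarrow> 'u) \<Rightarrow> bool"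
  where "extension_property U \<longleftrightarrow> (\<forall>P. finite P \<longrightarrow> fixed_realised UNIV U (range_dist U) P \<and>
    (\<forall>b \<delta>. moved_realised UNIV U (range_dist U) P b \<delta>))"

lemma finite_saturate: "finite P \<Longrightarrow> finite (saturate R P)"
  by (simp add: saturate_def)

lemma saturate_iff: "(c, s) \<in> saturate R P \<longleftrightarrow> (c, s) \<in> P \<or> (\<exists>b. (b, s) \<in> P \<and> c = R b)"
  by (auto simp: saturate_def map_prod_def image_iff)

section \<open>Finite partial embeddings and their extension by one point\<close>

definition structure_embedding :: "('a \<Rightarrow> 'a \<Rightarrow> real) \<Rightarrow> ('a \<Rightarrow> 'a) \<Rightarrow> ('a \<Rightarrow> real) \<Rightarrow>
    ('u::metric_space \<Rightarrow> 'u) \<Rightarrow> 'a set \<Rightarrow> ('a \<Rightarrow> 'u) \<Rightarrow> bool"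
  where "structure_embedding d R D U F i \<longleftrightarrow>
    isometric_on F d i \<and> (\<forall>x\<in>F. i (R x) = U (i x) \<and> D x = range_dist U (i x))"

lemma structure_embedding_cong:
  assumes "structure_embedding d R D U F i" "R ` F \<subseteq> F" "\<And>x. x \<in> F \<Longrightarrow> i' x = i x"
  shows "structure_embedding d R D U F i'"
  using assms by (auto simp: structure_embedding_def isometric_on_def image_subset_iff)

lemma structure_embedding_insert:
  assumes "Metric_space X d" "structure_embedding d R D U F i" "F \<subseteq> X" "R ` F \<subseteq> F" "q \<in> X" "q \<notin> F"
    and "\<And>x. x \<in> F \<Longrightarrow> dist y (i x) = d q x" "(i(q := y)) (R q) = U y" "D q = range_dist U y"
  shows "structure_embedding d R D U (insert q F) (i(q := y))"
proof -
  interpret Metric_space X d by fact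
  have "R x \<noteq> q" if "x \<in> F" for x using assms(4,6) that by auto
  then show ?thesis
    using assms(2-) unfolding structure_embedding_def isometric_on_def
    by (auto simp: dist_commute commute)
qed

text \<open>Bounds that lie above the distances from an actual point \<open>q\<close> are
  consistent, and \<open>kat\<close> returns every entry that is a true distance. Asking only for
  \<open>d q z \<le> t\<close> admits the extra entries from saturation and from
  \<open>2 * D q\<close>.\<close>

lemma kat_of_distances:
  assumes "Metric_space X d" "isometric_on F d i" "F \<subseteq> X" "q \<in> X" "finite P"
    and P: "\<And>c t. (c, t) \<in> P \<Longrightarrow> \<exists>z\<in>F. c = i z \<and> d q z \<le> t"
  shows "katetov P" "x \<in> F \<Longrightarrow> (i x, d q x) \<in> P \<Longrightarrow> kat P (i x) = d q x"
proof -
  interpret Metric_space X d by fact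
  have iso: "dist (i x) (i y) = d x y" if "x \<in> F" "y \<in> F" for x y
    using assms(2) that by (auto simp: isometric_on_def)
  show "katetov P"
    unfolding katetov_def
  proof (clarify)
    fix c t c' t' assume "(c, t) \<in> P" "(c', t') \<in> P"
    then obtain z z' where z: "z \<in> F" "c = i z" "d q z \<le> t" "z' \<in> F" "c' = i z'" "d q z' \<le> t'"
      using P by metis
    have "d z z' \<le> d z q + d q z'" using z assms(3,4) by (intro triangle) auto
    with z show "dist c c' \<le> t + t'" by (simp add: iso commute)
  qed
  assume x: "x \<in> F" "(i x, d q x) \<in> P"
  show "kat P (i x) = d q x"
  proof (rule kat_eqI[OF assms(5) x(2)])
    fix c t assume "(c, t) \<in> P"
    then obtain z where z: "z \<in> F" "c = i z" "d q z \<le> t" using P by metis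
    have "d q x \<le> d q z + d z x" using z x assms(3,4) by (intro triangle) auto
    with z x show "d q x \<le> t + dist c (i x)" by (simp add: iso)
  qed
qed

text \<open>The distances from \<open>q\<close> are prescribed at the images of \<open>F\<close>.
  Saturation adds the bound \<open>d q x\<close> at \<open>i (R x)\<close>; this is harmless because
  \<open>d q (R x) \<le> d q x\<close> for a fixed point \<open>q\<close>, so the true distances are
  realised.\<close>

lemma extend_embedding_fixed:
  assumes "retraction_structure X d R D" "U \<in> retractions" "extension_property U"
    and F: "finite F" "F \<subseteq> X" "R ` F \<subseteq> F" "structure_embedding d R D U F i"
    and q: "q \<in> X" "R q = q"
  obtains i' where "structure_embedding d R D U (insert q F) i'" "\<And>x. x \<in> F \<Longrightarrow> i' x = i x"
proof (cases "q \<in> F")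
  case True
  with F show thesis by (intro that[of i]) (simp_all add: insert_absorb)
next
  case False
  interpret retraction_structure X d R D by fact
  interpret U: retraction_structure UNIV dist U "range_dist U"
    by (rule retraction_structure_UNIV) fact
  define P where "P = (\<lambda>x. (i x, d q x)) ` F"
  have P: "finite P" using F by (simp add: P_def)
  have U: "U (i x) = i (R x)" "D x = range_dist U (i x)" if "x \<in> F" for x
    using F(4) that by (auto simp: structure_embedding_def)
  have iso: "isometric_on F d i" using F(4) by (auto simp: structure_embedding_def)
  have FX: "x \<in> X" "R x \<in> F" if "x \<in> F" for x using F that by auto
  have sat: "\<exists>z\<in>F. c = i z \<and> d q z \<le> t" if ct: "(c, t) \<in> saturate U P" for c t
  proof -
    obtain x where x: "x \<in> F" "t = d q x" "c = i x \<or> c = U (i x)"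
      using ct by (auto simp: saturate_iff P_def)
    have "d q (R x) \<le> d q x" using R_lip[OF q(1) FX(1)[OF x(1)]] q(2) by simp
    with x U FX show ?thesis by auto
  qed
  have kat1: "katetov (saturate U P)"
    by (rule kat_of_distances(1)[OF Metric_space_axioms iso F(2) q(1) finite_saturate[OF P] sat])
  have kat2: "kat (saturate U P) (i x) = d q x" if "x \<in> F" "(i x, d q x) \<in> saturate U P" for x
    by (rule kat_of_distances(2)[OF Metric_space_axioms iso F(2) q(1) finite_saturate[OF P] sat that])
  have "D x \<le> d q x" if "x \<in> F" for x
    using D_lip[OF FX(1)[OF that] q(1)] D_R[OF q(1)] q(2) commute by simp
  then have "fixed_data U (range_dist U) P"
    using kat1 U by (auto simp: fixed_data_def P_def)
  then obtain y where y: "U y = y" "\<forall>(c, s)\<in>P. dist y c = kat (saturate U P) c"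
    using assms(3) P unfolding extension_property_def fixed_realised_def moved_realised_def by blast
  have "dist y (i x) = d q x" if "x \<in> F" for x
    using y(2) kat2[OF that] that by (auto simp: P_def saturate_iff)
  moreover have "range_dist U y = 0" using U.D_R[of y] y(1) by simp
  moreover have "D q = 0" using D_R[OF q(1)] q(2) by simp
  ultimately have "structure_embedding d R D U (insert q F) (i(q := y))"
    using F q False y(1) by (intro structure_embedding_insert[OF Metric_space_axioms]) auto
  then show thesis using False by (intro that[of "i(q := y)"]) auto
qed

text \<open>\<open>R q\<close> goes in first, since moved data need the image of the new point. The
  bound \<open>2 * D q\<close> at that image is at least the true distance by \<open>dist_R\<close>,
  so it does not lower any of the prescribed distances.\<close>

lemma extend_embedding:
  assumes "retraction_structure X d R D" "U \<in> retractions" "extension_property U"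
    and F: "finite F" "F \<subseteq> X" "R ` F \<subseteq> F" "structure_embedding d R D U F i"
    and q: "q \<in> X"
  obtains F' i' where "finite F'" "F' \<subseteq> X" "R ` F' \<subseteq> F'" "structure_embedding d R D U F' i'"
    "insert q F \<subseteq> F'" "\<And>x. x \<in> F \<Longrightarrow> i' x = i x"
proof -
  interpret retraction_structure X d R D by fact
  obtain j where j: "structure_embedding d R D U (insert (R q) F) j" "\<And>x. x \<in> F \<Longrightarrow> j x = i x"
    using extend_embedding_fixed[OF assms(1-3) F R_in[OF q] R_idem[OF q]] by blast
  define G where "G = insert (R q) F"
  have G: "finite G" "G \<subseteq> X" "R ` G \<subseteq> G" "structure_embedding d R D U G j" "R q \<in> G"
    using F j R_in R_idem q by (auto simp: G_def)
  show thesis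
  proof (cases "q \<in> G")
    case True
    with G j(2) show thesis by (intro that[of G j]) (auto simp: G_def)
  next
    case False
    define P where "P = (\<lambda>x. (j x, d q x)) ` G"
    have P: "finite P" using G by (simp add: P_def)
    have U: "U (j x) = j (R x)" "D x = range_dist U (j x)" if "x \<in> G" for x
      using G(4) that by (auto simp: structure_embedding_def)
    have iso: "isometric_on G d j" using G(4) by (auto simp: structure_embedding_def)
    have GX: "x \<in> X" "R x \<in> G" if "x \<in> G" for x using G that by auto
    have Ub: "U (j (R q)) = j (R q)" using U(1)[OF G(5)] R_idem[OF q] by simp
    let ?P = "insert (U (j (R q)), 2 * D q) P"
    have sat: "\<exists>z\<in>G. c = j z \<and> d q z \<le> t" if ct: "(c, t) \<in> ?P" for c t
      using ct G(5) dist_R[OF q] Ub by (auto simp: P_def)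
    have "finite ?P" using P by simp
    have kat1: "katetov ?P"
      by (rule kat_of_distances(1)[OF Metric_space_axioms iso G(2) q \<open>finite ?P\<close> sat])
    have kat2: "kat ?P (j x) = d q x" if "x \<in> G" "(j x, d q x) \<in> ?P" for x
      by (rule kat_of_distances(2)[OF Metric_space_axioms iso G(2) q \<open>finite ?P\<close> sat that])
    have "dist (j (R q)) (j (R x)) \<le> d q x" "\<bar>D q - D x\<bar> \<le> d q x" if "x \<in> G" for x
      using R_lip[OF q GX(1)[OF that]] D_lip[OF q GX(1)[OF that]] D_lip[OF GX(1)[OF that] q]
        iso GX[OF that] G(5) commute[of q x] by (auto simp: isometric_on_def)
    then have "moved_data U (range_dist U) P (j (R q)) (D q)"
      using kat1 P U Ub by (fastforce simp: moved_data_def P_def)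
    then obtain y where y: "U y = U (j (R q))" "range_dist U y = D q"
      "\<forall>(c, s)\<in>P. dist y c = kat ?P c"
      using assms(3) P unfolding extension_property_def fixed_realised_def moved_realised_def by blast
    have "dist y (j x) = d q x" if "x \<in> G" for x
      using y(3) kat2[OF that] that by (auto simp: P_def)
    moreover have "R q \<noteq> q" using G(5) False by auto
    ultimately have "structure_embedding d R D U (insert q G) (j(q := y))"
      using G q False y Ub by (intro structure_embedding_insert[OF Metric_space_axioms]) auto
    moreover have "R ` insert q G \<subseteq> insert q G" using G by auto
    ultimately show thesis
      using G q j(2) False by (intro that[of "insert q G" "j(q := y)"]) (auto simp: G_def)
  qed
qed

text \<open>Dependent choice for growing partial maps, with one goal per stage. The type of values
  is free: points of the space for embeddings, pairs \<open>(R x, D x)\<close> for retraction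
  structures. The limit map \<open>g\<close> agrees with the map of a stage only on the set of that
  stage, whence the congruence assumptions.\<close>

lemma extension_chain:
  fixes Inv :: "'a set \<Rightarrow> ('a \<Rightarrow> 'b) \<Rightarrow> bool" and Goal :: "nat \<Rightarrow> 'a set \<Rightarrow> ('a \<Rightarrow> 'b) \<Rightarrow> bool"
  assumes init: "Inv F0 i0"
    and step: "\<And>n F i. Inv F i \<Longrightarrow>
      \<exists>F' i'. Inv F' i' \<and> F \<subseteq> F' \<and> (\<forall>x\<in>F. i' x = i x) \<and> Goal n F' i'"
    and Inv_cong: "\<And>F i i'. Inv F i \<Longrightarrow> \<forall>x\<in>F. i' x = i x \<Longrightarrow> Inv F i'"
    and Goal_cong: "\<And>n F i i'. Inv F i \<Longrightarrow> Goal n F i \<Longrightarrow> \<forall>x\<in>F. i' x = i x \<Longrightarrow> Goal n F i'"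
  obtains Fs g where "Fs 0 = F0" "\<And>x. x \<in> F0 \<Longrightarrow> g x = i0 x" "\<And>n. Inv (Fs n) g" "incseq Fs"
    "\<And>n. Goal n (Fs (Suc n)) g"
proof -
  define Q where "Q n s s' \<longleftrightarrow> fst s \<subseteq> fst s' \<and> (\<forall>x\<in>fst s. snd s' x = snd s x) \<and>
    Goal n (fst s') (snd s')" for n s s'
  \<comment> \<open>The clause for \<open>n = 0\<close> pins the start, as
    \<open>dependent_nat_choice\<close> by itself yields just some initial stage.\<close>
  define J where "J n s \<longleftrightarrow> Inv (fst s) (snd s) \<and> (n = 0 \<longrightarrow> s = (F0, i0))" for n :: nat and s
  have "\<exists>f. \<forall>n. J n (f n) \<and> Q n (f n) (f (Suc n))"
  proof (rule dependent_nat_choice)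
    show "\<exists>s. J 0 s" using init by (auto simp: J_def)
    fix s n assume "J n s"
    then have "Inv (fst s) (snd s)" by (simp add: J_def)
    from step[OF this, of n] show "\<exists>s'. J (Suc n) s' \<and> Q n s s'"
      by (auto simp: J_def Q_def)
  qed
  then obtain f where J: "\<And>n. J n (f n)" and Q: "\<And>n. Q n (f n) (f (Suc n))" by blast
  define Fs where "Fs n = fst (f n)" for n
  define g where "g x = snd (f (LEAST n. x \<in> Fs n)) x" for x
  have mono: "Fs m \<subseteq> Fs n \<and> (\<forall>x\<in>Fs m. snd (f n) x = snd (f m) x)" if "m \<le> n" for m n
    using that
  proof (induction rule: dec_induct)
    case (step n)
    then show ?case using Q[of n] by (auto simp: Q_def Fs_def subset_iff)
  qed simp
  have g: "g x = snd (f n) x" if "x \<in> Fs n" for x n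
  proof -
    have "x \<in> Fs (LEAST n. x \<in> Fs n)" using that by (rule LeastI)
    then show ?thesis using mono[OF Least_le[of "\<lambda>n. x \<in> Fs n", OF that]] by (simp add: g_def)
  qed
  show thesis
  proof
    show "Fs 0 = F0" using J[of 0] by (simp add: J_def Fs_def)
    show "g x = i0 x" if "x \<in> F0" for x using g[of x 0] J[of 0] that by (simp add: J_def Fs_def)
    show "incseq Fs" using mono by (auto simp: incseq_def)
    show "Inv (Fs n) g" for n
      by (rule Inv_cong[of "Fs n" "snd (f n)"]) (use J[of n] g[of _ n] in \<open>simp_all add: J_def Fs_def\<close>)
    show "Goal n (Fs (Suc n)) g" for n
      by (rule Goal_cong[of "Fs (Suc n)" "snd (f (Suc n))"])
        (use J[of "Suc n"] Q[of n] g[of _ "Suc n"] in \<open>simp_all add: J_def Q_def Fs_def\<close>)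
  qed
qed

text \<open>The bounds say that \<open>\<rho>\<close> behaves like the distance to a point in the
  closure of the image of \<open>F\<close> under \<open>g\<close>. Points at which
  \<open>\<rho>\<close> tends to 0 have a Cauchy sequence of images, and its limit is the point
  wanted.\<close>

lemma point_at_distances:
  fixes g :: "'a \<Rightarrow> 'u::complete_space"
  assumes small: "\<And>e. e > 0 \<Longrightarrow> \<exists>z\<in>F. \<rho> z < e"
    and bounds: "\<And>z z'. z \<in> F \<Longrightarrow> z' \<in> F \<Longrightarrow> \<rho> z \<le> \<rho> z' + dist (g z) (g z')"
      "\<And>z z'. z \<in> F \<Longrightarrow> z' \<in> F \<Longrightarrow> dist (g z) (g z') \<le> \<rho> z + \<rho> z'"
  obtains y where "\<And>z. z \<in> F \<Longrightarrow> dist y (g z) = \<rho> z"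
proof -
  have "\<exists>z\<in>F. \<rho> z < inverse (real (Suc n))" for n by (rule small) simp
  then obtain z where z: "\<And>n. z n \<in> F" "\<And>n. \<rho> (z n) < inverse (real (Suc n))" by metis
  have "0 \<le> \<rho> (z n)" for n using bounds(2)[OF z(1) z(1), of n n] by simp
  then have lim: "(\<lambda>n. \<rho> (z n)) \<longlonglongrightarrow> 0"
    using z(2) by (intro tendsto_sandwich[OF _ _ tendsto_const LIMSEQ_inverse_real_of_nat])
      (auto intro!: always_eventually less_imp_le)
  have "Cauchy (\<lambda>n. g (z n))"
  proof (rule metric_CauchyI)
    fix e :: real assume "e > 0"
    then have "eventually (\<lambda>n. \<rho> (z n) < e / 2) sequentially"
      using order_tendstoD(2)[OF lim, of "e / 2"] by simp
    then obtain N where "\<And>n. n \<ge> N \<Longrightarrow> \<rho> (z n) < e / 2"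
      by (auto simp: eventually_sequentially)
    then show "\<exists>N. \<forall>m\<ge>N. \<forall>n\<ge>N. dist (g (z m)) (g (z n)) < e"
      using bounds(2)[OF z(1) z(1)] by (smt (verit) field_sum_of_halves)
  qed
  then obtain y where y: "(\<lambda>n. g (z n)) \<longlonglongrightarrow> y"
    using Cauchy_convergent convergent_def by blast
  have "dist y (g x) = \<rho> x" if "x \<in> F" for x
  proof (rule LIMSEQ_unique)
    show "(\<lambda>n. dist (g (z n)) (g x)) \<longlonglongrightarrow> dist y (g x)" by (intro tendsto_intros y)
    have "(\<lambda>n. \<rho> x - \<rho> (z n)) \<longlonglongrightarrow> \<rho> x - 0" "(\<lambda>n. \<rho> x + \<rho> (z n)) \<longlonglongrightarrow> \<rho> x + 0"
      by (intro tendsto_intros lim)+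
    then have l: "(\<lambda>n. \<rho> x - \<rho> (z n)) \<longlonglongrightarrow> \<rho> x" "(\<lambda>n. \<rho> x + \<rho> (z n)) \<longlonglongrightarrow> \<rho> x" by simp_all
    show "(\<lambda>n. dist (g (z n)) (g x)) \<longlonglongrightarrow> \<rho> x"
    proof (rule tendsto_sandwich[OF _ _ l])
      show "\<forall>\<^sub>F n in sequentially. \<rho> x - \<rho> (z n) \<le> dist (g (z n)) (g x)"
        using bounds(1)[OF that z(1)] by (auto intro!: always_eventually simp: dist_commute algebra_simps)
      show "\<forall>\<^sub>F n in sequentially. dist (g (z n)) (g x) \<le> \<rho> x + \<rho> (z n)"
        using bounds(2)[OF z(1) that] by (auto intro!: always_eventually simp: add.commute)
    qed
  qed
  then show thesis by (rule that)
qed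

lemma structure_embedding_Union:
  assumes "incseq Fs" "\<And>n. R ` Fs n \<subseteq> Fs n" "\<And>n. structure_embedding d R D U (Fs n) g"
  shows "R ` (\<Union>n. Fs n) \<subseteq> (\<Union>n. Fs n)" "structure_embedding d R D U (\<Union>n. Fs n) g"
proof -
  have "dist (g x) (g y) = d x y" if "x \<in> Fs m" "y \<in> Fs n" for x y m n
  proof -
    have "x \<in> Fs (max m n)" "y \<in> Fs (max m n)"
      using incseqD[OF assms(1), of m "max m n"] incseqD[OF assms(1), of n "max m n"] that by auto
    then show ?thesis
      using assms(3)[of "max m n"] by (auto simp: structure_embedding_def isometric_on_def)
  qed
  then show "structure_embedding d R D U (\<Union>n. Fs n) g"
    using assms(3) by (auto simp: structure_embedding_def isometric_on_def)
  show "R ` (\<Union>n. Fs n) \<subseteq> (\<Union>n. Fs n)" using assms(2) by blast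
qed

lemma dist_eq_0_if_small: "(\<And>e. e > 0 \<Longrightarrow> dist x y < e) \<Longrightarrow> x = (y::'u::metric_space)"
  by (metis less_irrefl zero_less_dist_iff)

text \<open>Each \<open>x\<close> is sent to the point whose distances to the image of
  \<open>F\<close> are those from \<open>x\<close> to \<open>F\<close>; density of \<open>F\<close>
  makes it available. Isometry and the compatibility with \<open>R\<close> and \<open>D\<close> pass
  from \<open>F\<close> to \<open>X\<close> because all maps involved are 1-Lipschitz.\<close>

lemma structure_embedding_closure:
  fixes g :: "'a \<Rightarrow> 'u::complete_space"
  assumes "retraction_structure X d R D" "U \<in> retractions"
    and F: "F \<subseteq> X" "R ` F \<subseteq> F" "structure_embedding d R D U F g"
    and dense: "\<And>x e. x \<in> X \<Longrightarrow> e > 0 \<Longrightarrow> \<exists>z\<in>F. d x z < e"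
  obtains i where "structure_embedding d R D U X i" "\<And>x. x \<in> F \<Longrightarrow> i x = g x"
proof -
  interpret retraction_structure X d R D by fact
  interpret U: retraction_structure UNIV dist U "range_dist U"
    by (rule retraction_structure_UNIV) fact
  have FX: "x \<in> X" "R x \<in> F" if "x \<in> F" for x using F that by auto
  have iso: "dist (g x) (g y) = d x y" if "x \<in> F" "y \<in> F" for x y
    using F(3) that by (auto simp: structure_embedding_def isometric_on_def)
  have "\<exists>y. \<forall>z\<in>F. dist y (g z) = d x z" if x: "x \<in> X" for x
  proof -
    obtain y where "\<And>z. z \<in> F \<Longrightarrow> dist y (g z) = d x z"
    proof (rule point_at_distances[of F "d x" g])
      show "\<exists>z\<in>F. d x z < e" if "e > 0" for e by (rule dense[OF x that])
      fix z z' assume z: "z \<in> F" "z' \<in> F"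
      show "d x z \<le> d x z' + dist (g z) (g z')"
        using triangle[OF x FX(1)[OF z(2)] FX(1)[OF z(1)]] iso[OF z] commute[of z z'] by simp
      show "dist (g z) (g z') \<le> d x z + d x z'"
        using triangle[OF FX(1)[OF z(1)] x FX(1)[OF z(2)]] iso[OF z] commute[of z x] by simp
    qed blast
    then show ?thesis by blast
  qed
  then obtain i where i: "\<And>x z. x \<in> X \<Longrightarrow> z \<in> F \<Longrightarrow> dist (i x) (g z) = d x z" by metis
  have ig: "i z = g z" if "z \<in> F" for z using i[OF FX(1)[OF that] that] FX(1)[OF that] by simp
  have iX: "dist (i x) (i y) = d x y" if xy: "x \<in> X" "y \<in> X" for x y
  proof (rule dist_eq_0_if_small)
    fix e :: real assume "e > 0"
    then obtain z where z: "z \<in> F" "d y z < e / 2" using dense[OF xy(2), of "e / 2"] by auto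
    show "dist (dist (i x) (i y)) (d x y) < e"
      using i[OF xy(1) z(1)] i[OF xy(2) z(1)] z(2) dist_triangle[of "i x" "i y" "g z"]
        dist_triangle[of "i x" "g z" "i y"] triangle[OF xy(1) FX(1)[OF z(1)] xy(2)]
        triangle[OF xy FX(1)[OF z(1)]] commute[of y z] dist_commute[of "i y" "g z"]
      unfolding dist_real_def by linarith
  qed
  have "i (R x) = U (i x) \<and> D x = range_dist U (i x)" if x: "x \<in> X" for x
  proof
    show "i (R x) = U (i x)"
    proof (rule dist_eq_0_if_small)
      fix e :: real assume "e > 0"
      then obtain z where z: "z \<in> F" "d x z < e / 2" using dense[OF x, of "e / 2"] by auto
      have "dist (i (R x)) (i (R z)) \<le> d x z"
        using iX[OF R_in[OF x] R_in[OF FX(1)[OF z(1)]]] R_lip[OF x FX(1)[OF z(1)]] by simp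
      moreover have "i (R z) = U (i z)"
        using ig z(1) FX(2) F(3) by (auto simp: structure_embedding_def)
      moreover have "dist (U (i z)) (U (i x)) \<le> d x z"
        using U.R_lip[of "i z" "i x"] iX[OF x FX(1)[OF z(1)]] by (simp add: dist_commute)
      ultimately show "dist (i (R x)) (U (i x)) < e"
        using z(2) dist_triangle[of "i (R x)" "U (i x)" "U (i z)"] by simp
    qed
    show "D x = range_dist U (i x)"
    proof (rule dist_eq_0_if_small)
      fix e :: real assume "e > 0"
      then obtain z where z: "z \<in> F" "d x z < e / 2" using dense[OF x, of "e / 2"] by auto
      have "D z = range_dist U (i z)"
        using ig z(1) F(3) by (auto simp: structure_embedding_def)
      then show "dist (D x) (range_dist U (i x)) < e"
        using z(2) D_lip[OF x FX(1)[OF z(1)]] D_lip[OF FX(1)[OF z(1)] x]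
          U.D_lip[of "i x" "i z"] U.D_lip[of "i z" "i x"] iX[OF x FX(1)[OF z(1)]] commute[of x z]
        unfolding dist_real_def dist_commute[of "i z" "i x"] by simp
    qed
  qed
  with iX have "structure_embedding d R D U X i"
    by (simp add: structure_embedding_def isometric_on_def)
  then show thesis using ig by (rule that)
qed

lemma separable_dense_sequence:
  assumes "Metric_space X d" "separable_space (Metric_space.mtopology X d)" "X \<noteq> {}"
  obtains q :: "nat \<Rightarrow> 'a" where "range q \<subseteq> X" "\<And>x e. x \<in> X \<Longrightarrow> e > 0 \<Longrightarrow> \<exists>n. d x (q n) < e"
proof -
  interpret Metric_space X d by fact
  obtain C where C: "countable C" "C \<subseteq> X" "mtopology closure_of C = X"
    using assms(2) by (auto simp: separable_space_def)
  have "C \<noteq> {}" using C(3) assms(3) by auto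
  note C' = range_from_nat_into[OF this C(1)]
  have "\<exists>n. d x (from_nat_into C n) < e" if x: "x \<in> X" and e: "e > 0" for x e
  proof -
    have "x \<in> mtopology closure_of C" using C x by simp
    then obtain c where c: "c \<in> C" "d x c < e"
      unfolding metric_closure_of mem_Collect_eq in_mball using e by blast
    then obtain n where "c = from_nat_into C n" using C' by (metis imageE)
    with c show ?thesis by auto
  qed
  with C' C(2) show thesis by (intro that[of "from_nat_into C"]) auto
qed

section \<open>From the extension property to universality and ultrahomogeneity\<close>

lemma extension_property_imp_universal:
  fixes U :: "'u::complete_space \<Rightarrow> 'u"
  assumes U: "U \<in> retractions" "extension_property U"
  shows "universal_retraction U"
  unfolding universal_retraction_def
proof (intro allI impI, elim conjE)
  fix X :: "real set" and d R
  assume X: "Metric_space X d" and sep: "separable_space (Metric_space.mtopology X d)"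
    and R: "lipschitz_retraction_on X d R"
  define D where "D = range_dist_on X d R"
  have S: "retraction_structure X d R D"
    unfolding D_def by (rule retraction_structure_range_dist_on[OF X R])
  show "\<exists>i. isometric_on X d i \<and>
            (\<forall>x\<in>X. i (R x) = U (i x) \<and> range_dist_on X d R x = range_dist U (i x))"
  proof (cases "X = {}")
    case True
    then show ?thesis by (auto simp: isometric_on_def)
  next
    case False
    obtain q :: "nat \<Rightarrow> real" where q: "range q \<subseteq> X" "\<And>x e. x \<in> X \<Longrightarrow> e > 0 \<Longrightarrow> \<exists>n. d x (q n) < e"
      using separable_dense_sequence[OF X sep False] by blast
    define Inv where "Inv F i \<longleftrightarrow>
      finite F \<and> F \<subseteq> X \<and> R ` F \<subseteq> F \<and> structure_embedding d R D U F i" for F i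
    obtain Fs g where Fs: "\<And>n. Inv (Fs n) g" "incseq Fs" "\<And>n. q n \<in> Fs (Suc n)"
    proof (rule extension_chain[of Inv "{}" "\<lambda>_. undefined" "\<lambda>n F i. q n \<in> F"])
      show "Inv {} (\<lambda>_. undefined)" by (simp add: Inv_def structure_embedding_def isometric_on_def)
      show "\<exists>F' i'. Inv F' i' \<and> F \<subseteq> F' \<and> (\<forall>x\<in>F. i' x = i x) \<and> q n \<in> F'" if I: "Inv F i" for n F i
      proof -
        have "q n \<in> X" using q(1) by auto
        then show ?thesis
          using I extend_embedding[OF S U, of F i "q n"] unfolding Inv_def
          by (metis insert_subset)
      qed
      show "Inv F i'" if "Inv F i" "\<forall>x\<in>F. i' x = i x" for F i i'
        using that structure_embedding_cong[of d R D U F i i'] by (simp add: Inv_def)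
    qed blast+
    let ?F = "\<Union>n. Fs n"
    have "R ` Fs n \<subseteq> Fs n" "structure_embedding d R D U (Fs n) g" for n
      using Fs(1) by (simp_all add: Inv_def)
    note F = structure_embedding_Union[OF Fs(2) this]
    have FX: "?F \<subseteq> X" using Fs(1) by (auto simp: Inv_def)
    have dense: "\<exists>z\<in>?F. d x z < e" if "x \<in> X" "e > 0" for x e
      using q(2)[OF that] Fs(3) by blast
    obtain i where "structure_embedding d R D U X i" "\<And>x. x \<in> ?F \<Longrightarrow> i x = g x"
      by (rule structure_embedding_closure[OF S U(1) FX F], rule dense) (assumption | rule that)+
    then show ?thesis by (auto simp: structure_embedding_def D_def)
  qed
qed

text \<open>Makes the back step of a back-and-forth argument a forth step for the inverse
  map.\<close>

lemma structure_embedding_inverse: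
  assumes "structure_embedding dist U (range_dist U) U F i" "U ` F \<subseteq> F"
  shows "structure_embedding dist U (range_dist U) U (i ` F) (inv_into F i)"
    "U ` i ` F \<subseteq> i ` F" "x \<in> F \<Longrightarrow> inv_into F i (i x) = x"
proof -
  have iso: "dist (i x) (i y) = dist x y" if "x \<in> F" "y \<in> F" for x y
    using assms(1) that by (auto simp: structure_embedding_def isometric_on_def)
  have iU: "i (U x) = U (i x)" "range_dist U x = range_dist U (i x)" if "x \<in> F" for x
    using assms(1) that by (auto simp: structure_embedding_def)
  have "inj_on i F"
  proof (rule inj_onI)
    fix x y assume "x \<in> F" "y \<in> F" "i x = i y"
    then show "x = y" using iso[of x y] by simp
  qed
  then have inv: "inv_into F i (i x) = x" if "x \<in> F" for x using that by simp
  then show "x \<in> F \<Longrightarrow> inv_into F i (i x) = x" .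
  have UF: "U x \<in> F" if "x \<in> F" for x using assms(2) that by auto
  show "U ` i ` F \<subseteq> i ` F" using iU(1) UF by (auto simp: iU(1)[symmetric])
  show "structure_embedding dist U (range_dist U) U (i ` F) (inv_into F i)"
    unfolding structure_embedding_def isometric_on_def
    using iso iU UF inv by (auto simp: iU(1)[symmetric])
qed

lemma extension_property_imp_ultrahomogeneous:
  fixes U :: "'u::polish_space \<Rightarrow> 'u"
  assumes U: "U \<in> retractions" "extension_property U"
  shows "ultrahomogeneous_retraction U"
  unfolding ultrahomogeneous_retraction_def
proof (intro allI impI, elim conjE)
  fix A1 A2 :: "'u set" and i :: "'u \<Rightarrow> 'u"
  assume A: "finite A1" "U ` A1 \<subseteq> A1" "isometric_on A1 dist i"
    "\<forall>x\<in>A1. i (U x) = U (i x) \<and> range_dist U x = range_dist U (i x)"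
  note S = retraction_structure_UNIV[OF U(1)]
  let ?E = "structure_embedding dist U (range_dist U) U"
  obtain C :: "'u set" where C: "countable C" "\<And>X. open X \<Longrightarrow> X \<noteq> {} \<Longrightarrow> \<exists>d\<in>C. d \<in> X"
    using countable_dense_setE by blast
  have ne: "C \<noteq> {}" using C(2)[of UNIV] by auto
  define q where "q = from_nat_into C"
  have q: "\<exists>n. dist x (q n) < e" if e: "e > 0" for x e
  proof -
    obtain c where "c \<in> C" "c \<in> ball x e" using C(2)[of "ball x e"] e by force
    then show ?thesis using range_from_nat_into[OF ne C(1)] unfolding q_def
      by (metis imageE mem_ball)
  qed
  define Inv where "Inv F i \<longleftrightarrow> finite F \<and> U ` F \<subseteq> F \<and> ?E F i" for F i
  obtain Fs g where Fs: "Fs 0 = A1" "\<And>x. x \<in> A1 \<Longrightarrow> g x = i x" "\<And>n. Inv (Fs n) g" "incseq Fs"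
    "\<And>n. q n \<in> Fs (Suc n) \<and> q n \<in> g ` Fs (Suc n)"
  proof (rule extension_chain[of Inv A1 i "\<lambda>n F i. q n \<in> F \<and> q n \<in> i ` F"])
    show "Inv A1 i" using A by (simp add: Inv_def structure_embedding_def)
    show "\<exists>F' i'. Inv F' i' \<and> F \<subseteq> F' \<and> (\<forall>x\<in>F. i' x = i x) \<and> q n \<in> F' \<and> q n \<in> i' ` F'"
      if I: "Inv F i" for n F i
    proof -
      note I = I[unfolded Inv_def, THEN conjunct1] I[unfolded Inv_def, THEN conjunct2, THEN conjunct1]
        I[unfolded Inv_def, THEN conjunct2, THEN conjunct2]
      obtain F1 i1 where 1: "finite F1" "U ` F1 \<subseteq> F1" "?E F1 i1" "insert (q n) F \<subseteq> F1"
        "\<And>x. x \<in> F \<Longrightarrow> i1 x = i x"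
        using extend_embedding[OF S U I(1) subset_UNIV I(2,3) UNIV_I] by metis
      note inv1 = structure_embedding_inverse[OF 1(3,2)]
      \<comment> \<open>The inverse of \<open>i1\<close> is extended so that \<open>q n\<close>
        enters its domain; inverting once more puts \<open>q n\<close> into the range. The new
        partial map is therefore the inverse of \<open>i2\<close>, defined on the image of
        \<open>F2\<close>.\<close>
      obtain F2 i2 where 2: "finite F2" "U ` F2 \<subseteq> F2" "?E F2 i2" "insert (q n) (i1 ` F1) \<subseteq> F2"
        "\<And>x. x \<in> i1 ` F1 \<Longrightarrow> i2 x = inv_into F1 i1 x"
        using extend_embedding[OF S U finite_imageI[OF 1(1)] subset_UNIV inv1(2,1) UNIV_I] by metis
      note inv2 = structure_embedding_inverse[OF 2(3,2)]
      have F1: "x = i2 (i1 x) \<and> i1 x \<in> F2" if "x \<in> F1" for x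
        using that 2(4,5) inv1(3) by auto
      show ?thesis
      proof (intro exI conjI ballI)
        show "Inv (i2 ` F2) (inv_into F2 i2)" using inv2(1,2) 2(1) by (simp add: Inv_def)
        show "F \<subseteq> i2 ` F2" "q n \<in> i2 ` F2" using F1 1(4) by blast+
        show "inv_into F2 i2 x = i x" if "x \<in> F" for x
        proof -
          have "x \<in> F1" using that 1(4) by auto
          then have "inv_into F2 i2 x = i1 x" using F1 inv2(3) by metis
          then show ?thesis using 1(5) that by simp
        qed
        show "q n \<in> inv_into F2 i2 ` i2 ` F2" using inv2(3) 2(4) by force
      qed
    qed
    show "Inv F i'" if "Inv F i" "\<forall>x\<in>F. i' x = i x" for F i i'
      using that structure_embedding_cong[of dist U "range_dist U" U F i i'] by (simp add: Inv_def)
    show "q n \<in> F \<and> q n \<in> i' ` F" if "q n \<in> F \<and> q n \<in> i ` F" "\<forall>x\<in>F. i' x = i x" for n F i i'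
      using that by force
  qed blast
  let ?F = "\<Union>n. Fs n"
  have "U ` Fs n \<subseteq> Fs n" "?E (Fs n) g" for n
    using Fs(3) by (simp_all add: Inv_def)
  note F = structure_embedding_Union[OF Fs(4) this]
  have dense: "\<exists>z\<in>?F. dist x z < e" if "x \<in> UNIV" "e > 0" for x e
    using q[OF that(2)] Fs(5) by blast
  obtain I where I: "?E UNIV I" "\<And>x. x \<in> ?F \<Longrightarrow> I x = g x"
    by (rule structure_embedding_closure[OF S U(1) subset_UNIV F], rule dense) (assumption | rule that)+
  have iso: "dist (g x) (g y) = dist x y" if "x \<in> ?F" "y \<in> ?F" for x y
    using F(2) that by (auto simp: structure_embedding_def isometric_on_def)
  have "surj I"
    unfolding surj_def
  proof
    fix y
    have small: "\<exists>z\<in>?F. dist y (g z) < e" if e: "e > 0" for e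
    proof -
      obtain n where n: "dist y (q n) < e" using q[OF e, of y] by blast
      moreover obtain z where "z \<in> Fs (Suc n)" "q n = g z" using Fs(5)[of n] by blast
      ultimately show ?thesis by (intro bexI[of _ z]) auto
    qed
    \<comment> \<open>Values of \<open>g\<close> come arbitrarily close to \<open>y\<close>. The
      distances from \<open>y\<close> to these values, read on the domain side, converge on a point
      there by completeness, and this point is the preimage.\<close>
    obtain x where x: "\<And>z. z \<in> ?F \<Longrightarrow> dist x z = dist y (g z)"
    proof (rule point_at_distances[of ?F "\<lambda>z. dist y (g z)" "\<lambda>z. z"])
      fix z z' assume z: "z \<in> ?F" "z' \<in> ?F"
      show "dist y (g z) \<le> dist y (g z') + dist z z'"
        using dist_triangle[of y "g z" "g z'"] iso[OF z(2,1)] by (simp add: dist_commute)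
      show "dist z z' \<le> dist y (g z) + dist y (g z')"
        using dist_triangle[of "g z" "g z'" y] iso[OF z] by (simp add: dist_commute)
    qed (use small in blast)+
    have "I x = y"
    proof (rule dist_eq_0_if_small)
      fix e :: real assume "e > 0"
      then obtain z where z: "z \<in> ?F" "dist y (g z) < e / 2" using small[of "e / 2"] by auto
      have "dist (I x) (I z) = dist x z"
        using I(1) by (auto simp: structure_embedding_def isometric_on_def)
      then show "dist (I x) y < e"
        using z(2) x[OF z(1)] I(2)[OF z(1)] dist_triangle[of "I x" y "g z"]
        by (simp add: dist_commute)
    qed
    then show "\<exists>x. y = I x" by blast
  qed
  moreover have "I x = i x" if "x \<in> A1" for x
  proof -
    have "x \<in> ?F" using Fs(1) that by blast
    then show ?thesis using I(2) Fs(2)[OF that] by simp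
  qed
  ultimately show "\<exists>I. surj I \<and> isometric_on UNIV dist I \<and> (\<forall>x\<in>A1. I x = i x) \<and>
      (\<forall>x. I (U x) = U (I x) \<and> range_dist U x = range_dist U (I x))"
    using I(1) by (intro exI[of _ I]) (simp add: structure_embedding_def)
qed

section \<open>Approximate realisation of rational data\<close>

text \<open>Being a fixed point is an exact equation and does not survive small changes of
  \<open>U\<close>. So \<open>y\<close> is arbitrary and \<open>U y\<close> takes its place, which
  is a fixed point for every retraction \<open>U\<close>.\<close>

definition fixed_near :: "('u::metric_space \<Rightarrow> 'u) \<Rightarrow> real \<Rightarrow> ('u \<times> real) set \<Rightarrow> bool"
  where "fixed_near U e P \<longleftrightarrow> (fixed_data U (range_dist U) P \<longrightarrow>
    (\<exists>y. \<forall>(c, s)\<in>P. \<bar>dist (U y) c - kat (saturate U P) c\<bar> < e))"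

definition moved_near :: "('u::metric_space \<Rightarrow> 'u) \<Rightarrow> real \<Rightarrow> ('u \<times> real) set \<Rightarrow> 'u \<Rightarrow> real \<Rightarrow> bool"
  where "moved_near U e P b \<delta> \<longleftrightarrow> (moved_data U (range_dist U) P b \<delta> \<longrightarrow>
    (\<exists>y. dist (U y) (U b) < e \<and> \<bar>range_dist U y - \<delta>\<bar> < e \<and>
      (\<forall>(c, s)\<in>P. \<bar>dist y c - kat (insert (U b, 2 * \<delta>) P) c\<bar> < e)))"

definition rational_data :: "'u set \<Rightarrow> ('u \<times> real) set set"
  where "rational_data C = {P. finite P \<and> P \<subseteq> C \<times> \<rat>}"

definition near_extension_property :: "'u set \<Rightarrow> ('u::metric_space \<Rightarrow> 'u) \<Rightarrow> bool"
  where "near_extension_property C U \<longleftrightarrow> (\<forall>e>0. \<forall>P\<in>rational_data C.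
    fixed_near U e P \<and> (\<forall>b\<in>C. \<forall>\<delta>\<in>\<rat>. moved_near U e P b \<delta>))"

lemma fixed_realised_imp_near:
  assumes "fixed_realised UNIV U (range_dist U) P" "e > 0"
  shows "fixed_near U e P"
  unfolding fixed_near_def
proof
  assume "fixed_data U (range_dist U) P"
  then obtain y where "U y = y" "\<forall>(c, s)\<in>P. dist y c = kat (saturate U P) c"
    using assms(1) unfolding fixed_realised_def by blast
  then show "\<exists>y. \<forall>(c, s)\<in>P. \<bar>dist (U y) c - kat (saturate U P) c\<bar> < e"
    using assms(2) by (intro exI[of _ y]) fastforce
qed

lemma moved_realised_imp_near:
  assumes "moved_realised UNIV U (range_dist U) P b \<delta>" "e > 0"
  shows "moved_near U e P b \<delta>"
  unfolding moved_near_def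
proof
  assume "moved_data U (range_dist U) P b \<delta>"
  then obtain y where "U y = U b" "range_dist U y = \<delta>"
    "\<forall>(c, s)\<in>P. dist y c = kat (insert (U b, 2 * \<delta>) P) c"
    using assms(1) unfolding moved_realised_def by blast
  then show "\<exists>y. dist (U y) (U b) < e \<and> \<bar>range_dist U y - \<delta>\<bar> < e \<and>
    (\<forall>(c, s)\<in>P. \<bar>dist y c - kat (insert (U b, 2 * \<delta>) P) c\<bar> < e)"
    using assms(2) by (intro exI[of _ y]) fastforce
qed

section \<open>Rounding arbitrary data to rational data over a dense set\<close>

lemma dense_approximation:
  fixes C :: "'u::metric_space set"
  assumes "\<And>X. open X \<Longrightarrow> X \<noteq> {} \<Longrightarrow> \<exists>d\<in>C. d \<in> X" "e > 0"
  obtains \<gamma> where "\<And>x. \<gamma> x \<in> C" "\<And>x. dist (\<gamma> x) x < e"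
proof -
  have "\<exists>c. c \<in> C \<and> dist c x < e" for x
    using assms(1)[of "ball x e"] assms(2) by (force simp: dist_commute)
  then show thesis using that by metis
qed

lemma rational_between:
  fixes e e' :: real
  assumes "e < e'"
  obtains \<sigma> where "\<And>s. \<sigma> s \<in> \<rat>" "\<And>s. s + e < \<sigma> s" "\<And>s. \<sigma> s < s + e'"
proof -
  have "\<exists>t. t \<in> \<rat> \<and> s + e < t \<and> t < s + e'" for s :: real
    using Rats_dense_in_real[of "s + e" "s + e'"] assms by auto
  then show thesis using that by metis
qed

lemma fixed_near_real:
  assumes C: "\<And>X. open X \<Longrightarrow> X \<noteq> {} \<Longrightarrow> \<exists>d\<in>C. d \<in> X"
    and U: "U \<in> retractions" "near_extension_property C U"
    and P: "finite P" "fixed_data U (range_dist U) P" and e: "e > 0"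
  obtains y where "U y = y" "\<And>c s. (c, s) \<in> P \<Longrightarrow> \<bar>dist y c - kat (saturate U P) c\<bar> < e"
proof -
  interpret retraction_structure UNIV dist U "range_dist U"
    by (rule retraction_structure_UNIV) fact
  \<comment> \<open>Error in units of \<open>\<eta>\<close>: 1 each for \<open>dist (U y)\<close>
    and \<open>kat\<close> when \<open>c\<close> is replaced by \<open>\<gamma> c\<close>, 6 for
    rounding the data (values 5, centres 1), and 1 for the approximation; 9 in all, within the 20
    available.\<close>
  define \<eta> where "\<eta> = e / 20"
  have \<eta>: "\<eta> > 0" "20 * \<eta> = e" using e by (simp_all add: \<eta>_def)
  obtain \<gamma> where \<gamma>: "\<And>x. \<gamma> x \<in> C" "\<And>x. dist (\<gamma> x) x < \<eta>" using dense_approximation[OF C \<eta>(1)] by blast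
  obtain \<sigma> where \<sigma>: "\<And>s. \<sigma> s \<in> \<rat>" "\<And>s. s + 4 * \<eta> < \<sigma> s" "\<And>s. \<sigma> s < s + 5 * \<eta>"
    using rational_between[of "4 * \<eta>" "5 * \<eta>"] \<eta>(1) by auto
  \<comment> \<open>The values are enlarged by more than the points are moved, so all inequalities persist.\<close>
  define P' where "P' = map_prod \<gamma> \<sigma> ` P"
  have fin: "finite P'" using P(1) by (simp add: P'_def)
  have U\<gamma>: "dist (U (\<gamma> x)) (U x) < \<eta>" for x using R_lip[of "\<gamma> x" x] \<gamma>(2)[of x] by simp
  have sat1: "\<exists>(c', s')\<in>saturate U P'. s' + dist c' c \<le> s + 6 * \<eta>" if "(c, s) \<in> saturate U P" for c s
  proof -
    consider "(c, s) \<in> P" | b where "(b, s) \<in> P" "c = U b" using \<open>(c, s) \<in> saturate U P\<close> unfolding saturate_iff by blast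
    then show ?thesis
    proof cases
      case 1
      then have "(\<gamma> c, \<sigma> s) \<in> saturate U P'" unfolding saturate_iff P'_def by force
      then show ?thesis by (rule rev_bexI) (use \<gamma>(2)[of c] \<sigma>(3)[of s] in simp)
    next
      case 2
      then have "(U (\<gamma> b), \<sigma> s) \<in> saturate U P'" unfolding saturate_iff P'_def by force
      then show ?thesis by (rule rev_bexI) (use U\<gamma>[of b] \<sigma>(3)[of s] 2 in simp)
    qed
  qed
  have sat2: "\<exists>c s. (c, s) \<in> saturate U P \<and> s' > s + 4 * \<eta> \<and> dist c c' < \<eta>"
    if "(c', s') \<in> saturate U P'" for c' s'
  proof -
    have "(\<exists>c s. (c, s) \<in> P \<and> c' = \<gamma> c \<and> s' = \<sigma> s) \<or> (\<exists>c s. (c, s) \<in> P \<and> c' = U (\<gamma> c) \<and> s' = \<sigma> s)"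
      using that unfolding saturate_iff P'_def by auto
    then show ?thesis
    proof (elim disjE exE conjE)
      fix c s assume "(c, s) \<in> P" "c' = \<gamma> c" "s' = \<sigma> s"
      then show ?thesis
        using \<gamma>(2)[of c] \<sigma>(2)[of s] by (intro exI[of _ c] exI[of _ s]) (simp add: saturate_iff dist_commute)
    next
      fix c s assume "(c, s) \<in> P" "c' = U (\<gamma> c)" "s' = \<sigma> s"
      then show ?thesis
        using U\<gamma>[of c] \<sigma>(2)[of s]
        by (intro exI[of _ "U c"] exI[of _ s]) (auto simp add: saturate_iff dist_commute)
    qed
  qed
  have "katetov (saturate U P')"
    unfolding katetov_def
  proof clarify
    fix c s c' s' assume "(c, s) \<in> saturate U P'" "(c', s') \<in> saturate U P'"
    then obtain a t a' t' where a: "(a, t) \<in> saturate U P" "s > t + 4 * \<eta>" "dist a c < \<eta>"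
      "(a', t') \<in> saturate U P" "s' > t' + 4 * \<eta>" "dist a' c' < \<eta>" using sat2 by metis
    have "dist a a' \<le> t + t'" using P(2) a katetovD unfolding fixed_data_def by blast
    then show "dist c c' \<le> s + s'"
      using a dist_triangle[of c c' a] dist_triangle[of a c' a'] \<eta>(1) by (simp add: dist_commute)
  qed
  moreover have "range_dist U c' \<le> s'" if cs': "(c', s') \<in> P'" for c' s'
  proof -
    obtain c s where c: "(c, s) \<in> P" "c' = \<gamma> c" "s' = \<sigma> s" using cs' by (auto simp: P'_def)
    then have "range_dist U c \<le> s" using P(2) by (auto simp: fixed_data_def)
    with c show ?thesis using D_lip[of "\<gamma> c" c] \<gamma>(2)[of c] \<sigma>(2)[of s] \<eta>(1) by simp
  qed
  ultimately have "fixed_data U (range_dist U) P'" by (auto simp: fixed_data_def)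
  moreover have "P' \<in> rational_data C" using fin \<gamma>(1) \<sigma>(1) by (auto simp: P'_def rational_data_def)
  then have "fixed_near U \<eta> P'" using U(2) \<eta>(1) by (simp add: near_extension_property_def)
  ultimately obtain y where y: "\<forall>(c, s)\<in>P'. \<bar>dist (U y) c - kat (saturate U P') c\<bar> < \<eta>"
    by (auto simp: fixed_near_def)
  have "\<bar>dist (U y) c - kat (saturate U P) c\<bar> < e" if "(c, s) \<in> P" for c s
  proof -
    have ne: "saturate U P \<noteq> {}" "saturate U P' \<noteq> {}"
      using that by (auto simp: saturate_def P'_def)
    note fs = finite_saturate[OF P(1), of U] finite_saturate[OF fin, of U]
    have "kat (saturate U P') (\<gamma> c) \<le> kat (saturate U P) (\<gamma> c) + 6 * \<eta>"
      by (rule kat_le_perturb[OF fs(1) ne(1) fs(2) sat1])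
    moreover have "kat (saturate U P) (\<gamma> c) \<le> kat (saturate U P') (\<gamma> c) + 6 * \<eta>"
    proof (rule kat_le_perturb[OF fs(2) ne(2) fs(1)])
      fix c' s' assume "(c', s') \<in> saturate U P'"
      then obtain a t where "(a, t) \<in> saturate U P" "s' > t + 4 * \<eta>" "dist a c' < \<eta>" using sat2 by blast
      then show "\<exists>(a, t)\<in>saturate U P. t + dist a c' \<le> s' + 6 * \<eta>" using \<eta>(1) by force
    qed
    moreover have "\<bar>dist (U y) (\<gamma> c) - kat (saturate U P') (\<gamma> c)\<bar> < \<eta>"
      using y that by (force simp: P'_def)
    ultimately show ?thesis
      using kat_lipschitz[OF fs(1) ne(1), of c "\<gamma> c"] kat_lipschitz[OF fs(1) ne(1), of "\<gamma> c" c]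
        \<gamma>(2)[of c] dist_triangle[of "U y" c "\<gamma> c"] dist_triangle[of "U y" "\<gamma> c" c] \<eta>
        dist_commute[of c "\<gamma> c"] by linarith
  qed
  then show thesis using R_idem[of y] by (intro that[of "U y"]) auto
qed

lemma moved_near_real:
  assumes C: "\<And>X. open X \<Longrightarrow> X \<noteq> {} \<Longrightarrow> \<exists>d\<in>C. d \<in> X"
    and U: "U \<in> retractions" "near_extension_property C U"
    and P: "finite P" "moved_data U (range_dist U) P b \<delta>" and e: "e > 0"
  obtains y where "dist (U y) (U b) < e" "\<bar>range_dist U y - \<delta>\<bar> < e"
    "\<And>c s. (c, s) \<in> P \<Longrightarrow> \<bar>dist y c - kat (insert (U b, 2 * \<delta>) P) c\<bar> < e"
proof -
  interpret retraction_structure UNIV dist U "range_dist U"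
    by (rule retraction_structure_UNIV) fact
  define \<eta> where "\<eta> = e / 20"
  have \<eta>: "\<eta> > 0" "20 * \<eta> = e" using e by (simp_all add: \<eta>_def)
  obtain \<gamma> where \<gamma>: "\<And>x. \<gamma> x \<in> C" "\<And>x. dist (\<gamma> x) x < \<eta>" using dense_approximation[OF C \<eta>(1)] by blast
  \<comment> \<open>The values must rise by more than \<open>\<delta>\<close> does:
    \<open>\<bar>\<delta>' - D c\<bar>\<close> can grow by 7 units of \<open>\<eta>\<close> through
    \<open>\<delta>'\<close> and by 1 through the centre, which 10 covers. The entry
    \<open>2 * \<delta>'\<close> rises by up to 14, or 15 with the displaced base point. The total
    error is below 15 + 1 + 2 = 18 units out of 20.\<close>
  obtain \<sigma> where \<sigma>: "\<And>s. \<sigma> s \<in> \<rat>" "\<And>s. s + 10 * \<eta> < \<sigma> s" "\<And>s. \<sigma> s < s + 11 * \<eta>"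
    using rational_between[of "10 * \<eta>" "11 * \<eta>"] \<eta>(1) by auto
  obtain \<delta>' where \<delta>': "\<delta>' \<in> \<rat>" "\<delta> + 6 * \<eta> < \<delta>'" "\<delta>' < \<delta> + 7 * \<eta>"
    using Rats_dense_in_real[of "\<delta> + 6 * \<eta>" "\<delta> + 7 * \<eta>"] \<eta>(1) by auto
  define P' where "P' = map_prod \<gamma> \<sigma> ` P"
  have fin: "finite P'" using P(1) by (simp add: P'_def)
  have U\<gamma>: "dist (U (\<gamma> x)) (U x) < \<eta>" for x using R_lip[of "\<gamma> x" x] \<gamma>(2)[of x] by simp
  let ?K = "insert (U b, 2 * \<delta>) P" and ?K' = "insert (U (\<gamma> b), 2 * \<delta>') P'"
  have K: "katetov ?K" and Kd: "\<And>c s. (c, s) \<in> P \<Longrightarrow> dist (U b) (U c) \<le> s \<and> \<bar>\<delta> - range_dist U c\<bar> \<le> s"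
    using P(2) by (auto simp: moved_data_def)
  have fs: "finite ?K" "?K \<noteq> {}" "finite ?K'" "?K' \<noteq> {}" using P(1) fin by auto
  have sat1: "\<exists>(c', s')\<in>?K'. s' + dist c' c \<le> s + 15 * \<eta>" if "(c, s) \<in> ?K" for c s
    using that
  proof (elim insertE)
    assume "(c, s) = (U b, 2 * \<delta>)"
    then show ?thesis using U\<gamma>[of b] \<delta>' by force
  next
    assume "(c, s) \<in> P"
    then have "(\<gamma> c, \<sigma> s) \<in> ?K'" by (force simp: P'_def)
    then show ?thesis by (rule rev_bexI) (use \<gamma>(2)[of c] \<sigma>(3)[of s] \<eta>(1) in simp)
  qed
  have sat2: "\<exists>c s. (c, s) \<in> ?K \<and> s' > s + 4 * \<eta> \<and> dist c c' < \<eta>" if "(c', s') \<in> ?K'" for c' s'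
    using that
  proof (elim insertE)
    assume "(c', s') = (U (\<gamma> b), 2 * \<delta>')"
    then show ?thesis
      using U\<gamma>[of b] \<delta>' \<eta>(1) by (intro exI[of _ "U b"] exI[of _ "2 * \<delta>"]) (simp add: dist_commute)
  next
    assume "(c', s') \<in> P'"
    then obtain c s where "(c, s) \<in> P" "c' = \<gamma> c" "s' = \<sigma> s" by (auto simp: P'_def)
    then show ?thesis
      using \<gamma>(2)[of c] \<sigma>(2)[of s] \<eta>(1) by (intro exI[of _ c] exI[of _ s]) (simp add: dist_commute)
  qed
  have "katetov ?K'"
    unfolding katetov_def
  proof (intro ballI, clarify)
    fix c s c' s' assume "(c, s) \<in> ?K'" "(c', s') \<in> ?K'"
    then obtain a t a' t' where a: "(a, t) \<in> ?K" "s > t + 4 * \<eta>" "dist a c < \<eta>"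
      "(a', t') \<in> ?K" "s' > t' + 4 * \<eta>" "dist a' c' < \<eta>" using sat2 by metis
    have "dist a a' \<le> t + t'" using katetovD[OF K a(1,4)] .
    then show "dist c c' \<le> s + s'"
      using a dist_triangle[of c c' a] dist_triangle[of a c' a'] \<eta>(1) by (simp add: dist_commute)
  qed
  moreover have "dist (U (\<gamma> b)) (U c') \<le> s' \<and> \<bar>\<delta>' - range_dist U c'\<bar> \<le> s'" if cs': "(c', s') \<in> P'" for c' s'
  proof -
    obtain c s where c: "(c, s) \<in> P" "c' = \<gamma> c" "s' = \<sigma> s" using cs' by (auto simp: P'_def)
    have "dist (U (\<gamma> b)) (U (\<gamma> c)) \<le> \<sigma> s"
      using Kd[OF c(1)] U\<gamma>[of b] U\<gamma>[of c] dist_triangle[of "U (\<gamma> b)" "U (\<gamma> c)" "U b"]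
        dist_triangle[of "U b" "U (\<gamma> c)" "U c"] \<sigma>(2)[of s] \<eta>(1) dist_commute[of "U c" "U (\<gamma> c)"] by linarith
    moreover have "\<bar>\<delta>' - range_dist U (\<gamma> c)\<bar> \<le> \<sigma> s"
      using Kd[OF c(1)] D_lip[of c "\<gamma> c"] D_lip[of "\<gamma> c" c] \<gamma>(2)[of c] \<delta>' \<sigma>(2)[of s] \<eta>(1)
        dist_commute[of c "\<gamma> c"] unfolding abs_le_iff by simp
    ultimately show ?thesis using c by simp
  qed
  ultimately have "moved_data U (range_dist U) P' (\<gamma> b) \<delta>'" by (auto simp: moved_data_def)
  moreover have "P' \<in> rational_data C" using fin \<gamma>(1) \<sigma>(1) by (auto simp: P'_def rational_data_def)
  then have "moved_near U \<eta> P' (\<gamma> b) \<delta>'"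
    using U(2) \<eta>(1) \<gamma>(1) \<delta>'(1) by (simp add: near_extension_property_def)
  ultimately obtain y where y: "dist (U y) (U (\<gamma> b)) < \<eta>" "\<bar>range_dist U y - \<delta>'\<bar> < \<eta>"
    "\<forall>(c, s)\<in>P'. \<bar>dist y c - kat ?K' c\<bar> < \<eta>"
    by (auto simp: moved_near_def)
  show thesis
  proof (rule that[of y])
    show "dist (U y) (U b) < e"
      using y(1) U\<gamma>[of b] dist_triangle[of "U y" "U b" "U (\<gamma> b)"] \<eta> by linarith
    show "\<bar>range_dist U y - \<delta>\<bar> < e" using y(2) \<delta>' \<eta> by linarith
    fix c s assume c: "(c, s) \<in> P"
    have "kat ?K' (\<gamma> c) \<le> kat ?K (\<gamma> c) + 15 * \<eta>"
      by (rule kat_le_perturb[OF fs(1,2,3) sat1])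
    moreover have "kat ?K (\<gamma> c) \<le> kat ?K' (\<gamma> c) + 15 * \<eta>"
    proof (rule kat_le_perturb[OF fs(3,4,1)])
      fix c' s' assume "(c', s') \<in> ?K'"
      then obtain a t where "(a, t) \<in> ?K" "s' > t + 4 * \<eta>" "dist a c' < \<eta>" using sat2 by blast
      then show "\<exists>(a, t)\<in>?K. t + dist a c' \<le> s' + 15 * \<eta>" using \<eta>(1) by force
    qed
    moreover have "\<bar>dist y (\<gamma> c) - kat ?K' (\<gamma> c)\<bar> < \<eta>"
      using y(3) c by (force simp: P'_def)
    ultimately show "\<bar>dist y c - kat ?K c\<bar> < e"
      using kat_lipschitz[OF fs(1,2), of c "\<gamma> c"] kat_lipschitz[OF fs(1,2), of "\<gamma> c" c]
        \<gamma>(2)[of c] dist_triangle[of "y" c "\<gamma> c"] dist_triangle[of "y" "\<gamma> c" c] \<eta>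
        dist_commute[of c "\<gamma> c"] by linarith
  qed
qed

section \<open>From approximate to exact realisations\<close>

lemma convergent_of_halving_steps:
  fixes y :: "nat \<Rightarrow> 'u::complete_space"
  assumes "\<And>n. dist (y (Suc n)) (y n) \<le> 2 * (1 / 2) ^ n"
  obtains l where "y \<longlonglongrightarrow> l"
proof -
  \<comment> \<open>Keeping the subtracted term makes the induction exact: the right side grows by
    \<open>2 * (1 / 2) ^ (n + k)\<close>, which is the bound for one step.\<close>
  have step: "dist (y (n + k)) (y n) \<le> 4 * (1 / 2) ^ n - 4 * (1 / 2) ^ (n + k)" for n k
  proof (induction k)
    case (Suc k)
    then show ?case
      using assms[of "n + k"] dist_triangle[of "y (Suc (n + k))" "y n" "y (n + k)"] by simp
  qed simp
  have le: "dist (y m) (y n) \<le> 4 * (1 / 2) ^ n" if "m \<ge> n" for m n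
  proof -
    have "0 \<le> (1 / 2 :: real) ^ m" by simp
    moreover have "dist (y m) (y n) \<le> 4 * (1 / 2) ^ n - 4 * (1 / 2) ^ m"
      using step[of n "m - n"] that by simp
    ultimately show ?thesis by linarith
  qed
  have "Cauchy y"
  proof (rule metric_CauchyI)
    fix e :: real assume "e > 0"
    then obtain N where N: "(1 / 2) ^ N < e / 8" using real_arch_pow_inv[of "e / 8" "1 / 2"] by auto
    show "\<exists>M. \<forall>m\<ge>M. \<forall>n\<ge>M. dist (y m) (y n) < e"
    proof (intro exI allI impI)
      fix m n assume "m \<ge> N" "n \<ge> N"
      then show "dist (y m) (y n) < e"
        using le[of N m] le[of N n] N dist_triangle[of "y m" "y n" "y N"] dist_commute[of "y n" "y N"]
        by linarith
    qed
  qed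
  then show thesis using that Cauchy_convergent convergent_def by blast
qed

lemma limit_eqI:
  fixes f :: "nat \<Rightarrow> 'b::metric_space"
  assumes "f \<longlonglongrightarrow> a" "\<And>n. dist (f n) b < (1 / 2) ^ n"
  shows "a = b"
proof (rule LIMSEQ_unique[OF assms(1)])
  have "(\<lambda>n. (1 / 2 :: real) ^ n) \<longlonglongrightarrow> 0" by (intro LIMSEQ_power_zero) simp
  then show "f \<longlonglongrightarrow> b"
  proof (rule metric_tendsto_imp_tendsto[OF _ always_eventually[OF allI]])
    show "dist (f n) b \<le> dist ((1 / 2 :: real) ^ n) 0" for n using assms(2)[of n] by simp
  qed
qed

lemma retraction_limits:
  assumes "U \<in> retractions" "y \<longlonglongrightarrow> l"
  shows "(\<lambda>n. U (y n)) \<longlonglongrightarrow> U l" "(\<lambda>n. range_dist U (y n)) \<longlonglongrightarrow> range_dist U l"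
proof -
  interpret retraction_structure UNIV dist U "range_dist U"
    by (rule retraction_structure_UNIV) fact
  show "(\<lambda>n. U (y n)) \<longlonglongrightarrow> U l"
    using R_lip by (intro metric_tendsto_imp_tendsto[OF assms(2)] always_eventually) auto
  show "(\<lambda>n. range_dist U (y n)) \<longlonglongrightarrow> range_dist U l"
  proof (intro metric_tendsto_imp_tendsto[OF assms(2)] always_eventually allI)
    show "dist (range_dist U (y n)) (range_dist U l) \<le> dist (y n) l" for n
      using D_lip[of "y n" l] D_lip[of l "y n"] by (simp add: dist_real_def dist_commute abs_le_iff)
  qed
qed

text \<open>An approximate realisation \<open>y\<close> with error \<open>e\<close> may be added to the data as \<open>(y, e)\<close> without changing
  the prescribed distances, so that the next approximation is close to \<open>y\<close>.\<close>

lemma fixed_exact: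
  fixes U :: "'u::complete_space \<Rightarrow> 'u"
  assumes C: "\<And>X. open X \<Longrightarrow> X \<noteq> {} \<Longrightarrow> \<exists>d\<in>C. d \<in> X"
    and U: "U \<in> retractions" "near_extension_property C U"
    and P: "finite P" "fixed_data U (range_dist U) P"
  shows "\<exists>y. U y = y \<and> (\<forall>(c, s)\<in>P. dist y c = kat (saturate U P) c)"
proof (cases "P = {}")
  case True
  interpret retraction_structure UNIV dist U "range_dist U"
    by (rule retraction_structure_UNIV) fact
  \<comment> \<open>Without data any fixed point serves.\<close>
  show ?thesis using True R_idem by (intro exI[of _ "U undefined"]) auto
next
  case False
  interpret retraction_structure UNIV dist U "range_dist U"
    by (rule retraction_structure_UNIV) fact
  define S where "S = saturate U P"
  have S: "finite S" "S \<noteq> {}" "P \<subseteq> S" "katetov S"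
    using P False by (auto simp: S_def finite_saturate saturate_def fixed_data_def)
  define J where "J n y \<longleftrightarrow> U y = y \<and> (\<forall>(c, s)\<in>P. \<bar>dist y c - kat S c\<bar> < (1 / 2) ^ n)" for n :: nat and y
  have "\<exists>y. \<forall>n. J n (y n) \<and> dist (y (Suc n)) (y n) \<le> 2 * (1 / 2) ^ n"
  proof (rule dependent_nat_choice)
    obtain y where "U y = y" "\<And>c s. (c, s) \<in> P \<Longrightarrow> \<bar>dist y c - kat (saturate U P) c\<bar> < (1 / 2) ^ 0"
      using fixed_near_real[OF C U P, of "(1 / 2) ^ 0"] by auto
    then show "\<exists>y. J 0 y" by (auto simp: J_def S_def)
    fix y n assume "J n y"
    then have y: "U y = y" "\<And>c s. (c, s) \<in> P \<Longrightarrow> \<bar>dist y c - kat S c\<bar> < (1 / 2) ^ n"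
      by (auto simp: J_def)
    let ?e = "(1 / 2 :: real) ^ n"
    let ?P = "insert (y, ?e) P"
    have sat: "saturate U ?P = insert (y, ?e) S" using y(1) by (auto simp: saturate_def S_def)
    have yP: "dist y c \<le> ?e + s" if "(c, s) \<in> P" for c s
      using y(2)[OF that] kat_le[OF S(1), of c s c] S(3) that by auto
    have yS: "dist y c \<le> ?e + s" if cs: "(c, s) \<in> S" for c s
    proof -
      consider "(c, s) \<in> P" | b where "(b, s) \<in> P" "c = U b" using cs by (auto simp: S_def saturate_iff)
      then show ?thesis
      proof cases
        case 2
        then show ?thesis using R_lip[of y b] y(1) yP[of b s] by simp
      qed (rule yP)
    qed
    have "katetov (saturate U ?P)"
      unfolding sat using S(4) yS by (auto simp: katetov_def dist_commute add.commute)
    moreover have "range_dist U y = 0" using D_R[of y] y(1) by simp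
    ultimately have "fixed_data U (range_dist U) ?P"
      using P(2) by (auto simp: fixed_data_def)
    then obtain y' where y': "U y' = y'"
      "\<And>c s. (c, s) \<in> ?P \<Longrightarrow> \<bar>dist y' c - kat (saturate U ?P) c\<bar> < (1 / 2) ^ Suc n"
      using fixed_near_real[OF C U _ _ zero_less_power, of ?P "1 / 2" "Suc n"] P(1) by auto
    \<comment> \<open>At the old centres \<open>?e + dist y c\<close> lies above
      \<open>kat S c\<close>, since \<open>y\<close> has the prescribed distances up to
      \<open>?e\<close>. So the new entry does not lower the minimum there.\<close>
    have "kat (saturate U ?P) c = kat S c" if "(c, s) \<in> P" for c s
      unfolding sat using y(2)[OF that] S by (simp add: kat_insert)
    then have J': "J (Suc n) y'" using y' by (fastforce simp: J_def)
    \<comment> \<open>The entry \<open>(y, ?e)\<close> caps the distance prescribed from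
      \<open>y\<close> at \<open>?e\<close>. With the error \<open>?e / 2\<close> of the next stage,
      the step stays below \<open>2 * ?e\<close>.\<close>
    have "kat (saturate U ?P) y \<le> ?e"
      using kat_le[of "saturate U ?P" y ?e y] S(1) by (simp add: sat)
    moreover have "\<bar>dist y' y - kat (saturate U ?P) y\<bar> < ?e / 2" "0 < ?e"
      using y'(2)[of y ?e] by simp_all
    ultimately have "dist y' y \<le> 2 * ?e" by linarith
    with J' show "\<exists>y'. J (Suc n) y' \<and> dist y' y \<le> 2 * ?e" by blast
  qed
  then obtain y where y: "\<And>n. J n (y n)" "\<And>n. dist (y (Suc n)) (y n) \<le> 2 * (1 / 2) ^ n" by blast
  obtain l where l: "y \<longlonglongrightarrow> l" using convergent_of_halving_steps[OF y(2)] by blast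
  have "(\<lambda>n. U (y n)) = y" using y(1) by (auto simp: J_def)
  then have "U l = l" using LIMSEQ_unique[OF retraction_limits(1)[OF U(1) l]] l by simp
  moreover have "dist l c = kat S c" if cs: "(c, s) \<in> P" for c s
  proof (rule limit_eqI[OF tendsto_dist[OF l tendsto_const]])
    show "dist (dist (y n) c) (kat S c) < (1 / 2) ^ n" for n
      using y(1)[of n] cs by (auto simp: J_def dist_real_def)
  qed
  ultimately show ?thesis unfolding S_def by blast
qed

lemma moved_exact:
  fixes U :: "'u::complete_space \<Rightarrow> 'u"
  assumes C: "\<And>X. open X \<Longrightarrow> X \<noteq> {} \<Longrightarrow> \<exists>d\<in>C. d \<in> X"
    and U: "U \<in> retractions" "near_extension_property C U"
    and P: "finite P" "moved_data U (range_dist U) P b \<delta>"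
  shows "\<exists>y. U y = U b \<and> range_dist U y = \<delta> \<and>
    (\<forall>(c, s)\<in>P. dist y c = kat (insert (U b, 2 * \<delta>) P) c)"
proof -
  interpret retraction_structure UNIV dist U "range_dist U"
    by (rule retraction_structure_UNIV) fact
  define S where "S = insert (U b, 2 * \<delta>) P"
  have S: "finite S" "S \<noteq> {}" "P \<subseteq> S" "katetov S" "(U b, 2 * \<delta>) \<in> S"
    using P by (auto simp: S_def moved_data_def)
  have "\<delta> \<ge> 0" using katetovD[OF S(4,5,5)] by simp
  \<comment> \<open>The pair \<open>(U b, 2 * \<delta>)\<close> satisfies the conditions on data as
    well, because \<open>U b\<close> is fixed and at distance 0 from the range. So \<open>S\<close>
    itself can be used as data.\<close>
  then have Sd: "dist (U b) (U c) \<le> s \<and> \<bar>\<delta> - range_dist U c\<bar> \<le> s" if "(c, s) \<in> S" for c s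
    using P(2) that R_idem[of b] D_R[of b] by (auto simp: S_def moved_data_def)
  \<comment> \<open>The bounds on \<open>U y\<close> and \<open>range_dist U y\<close> are what
    makes \<open>(y, (1 / 2) ^ n)\<close> admissible as a further entry. Controlling the error on
    all of \<open>S\<close> makes it consistent with the pair of \<open>U b\<close> too.\<close>
  define J where "J n y \<longleftrightarrow> dist (U y) (U b) < (1 / 2) ^ n \<and> \<bar>range_dist U y - \<delta>\<bar> < (1 / 2) ^ n \<and>
    (\<forall>(c, s)\<in>S. \<bar>dist y c - kat S c\<bar> < (1 / 2) ^ n)" for n :: nat and y
  have "\<exists>y. \<forall>n. J n (y n) \<and> dist (y (Suc n)) (y n) \<le> 2 * (1 / 2) ^ n"
  proof (rule dependent_nat_choice)
    have "insert (U b, 2 * \<delta>) S = S" using S(5) by auto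
    moreover have "moved_data U (range_dist U) S b \<delta>"
      using Sd S(4,5) by (auto simp: moved_data_def insert_absorb)
    ultimately obtain y where "dist (U y) (U b) < (1 / 2) ^ 0" "\<bar>range_dist U y - \<delta>\<bar> < (1 / 2) ^ 0"
      "\<And>c s. (c, s) \<in> S \<Longrightarrow> \<bar>dist y c - kat S c\<bar> < (1 / 2) ^ 0"
      using moved_near_real[OF C U S(1), of b \<delta> "(1 / 2) ^ 0"] by auto
    then show "\<exists>y. J 0 y" by (auto simp: J_def)
    fix y n assume "J n y"
    then have y: "dist (U y) (U b) < (1 / 2) ^ n" "\<bar>range_dist U y - \<delta>\<bar> < (1 / 2) ^ n"
      "\<And>c s. (c, s) \<in> S \<Longrightarrow> \<bar>dist y c - kat S c\<bar> < (1 / 2) ^ n"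
      by (auto simp: J_def)
    let ?e = "(1 / 2 :: real) ^ n"
    let ?P = "insert (y, ?e) S"
    have ins: "insert (U b, 2 * \<delta>) ?P = ?P" using S(5) by auto
    have yS: "dist y c \<le> ?e + s" if "(c, s) \<in> S" for c s
      using y(3)[OF that] kat_le[OF S(1) that, of c] by simp
    have "katetov ?P"
      using S(4) yS by (auto simp: katetov_def dist_commute add.commute)
    then have "moved_data U (range_dist U) ?P b \<delta>"
      unfolding moved_data_def ins using Sd y(1,2) by (auto simp: dist_commute)
    then obtain y' where y': "dist (U y') (U b) < (1 / 2) ^ Suc n" "\<bar>range_dist U y' - \<delta>\<bar> < (1 / 2) ^ Suc n"
      "\<And>c s. (c, s) \<in> ?P \<Longrightarrow> \<bar>dist y' c - kat ?P c\<bar> < (1 / 2) ^ Suc n"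
      using moved_near_real[OF C U _ _ zero_less_power, of ?P b \<delta> "1 / 2" "Suc n"] S(1) unfolding ins by auto
    have "kat ?P c = kat S c" if "(c, s) \<in> S" for c s
      using y(3)[OF that] S by (simp add: kat_insert)
    then have J': "J (Suc n) y'" using y' by (fastforce simp: J_def)
    have "kat ?P y \<le> ?e"
      using kat_le[of ?P y ?e y] S(1) by simp
    moreover have "\<bar>dist y' y - kat ?P y\<bar> < ?e / 2" "0 < ?e"
      using y'(3)[of y ?e] by simp_all
    ultimately have "dist y' y \<le> 2 * ?e" by linarith
    with J' show "\<exists>y'. J (Suc n) y' \<and> dist y' y \<le> 2 * ?e" by blast
  qed
  then obtain y where y: "\<And>n. J n (y n)" "\<And>n. dist (y (Suc n)) (y n) \<le> 2 * (1 / 2) ^ n" by blast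
  obtain l where l: "y \<longlonglongrightarrow> l" using convergent_of_halving_steps[OF y(2)] by blast
  have "U l = U b"
    using y(1) by (intro limit_eqI[OF retraction_limits(1)[OF U(1) l]]) (simp add: J_def)
  moreover have "range_dist U l = \<delta>"
    using y(1) by (intro limit_eqI[OF retraction_limits(2)[OF U(1) l]]) (simp add: J_def dist_real_def)
  moreover have "dist l c = kat S c" if cs: "(c, s) \<in> P" for c s
  proof (rule limit_eqI[OF tendsto_dist[OF l tendsto_const]])
    show "dist (dist (y n) c) (kat S c) < (1 / 2) ^ n" for n
      using y(1)[of n] S(3) cs by (auto simp: J_def dist_real_def)
  qed
  ultimately show ?thesis unfolding S_def by blast
qed

lemma near_extension_property_imp_extension_property:
  fixes U :: "'u::complete_space \<Rightarrow> 'u"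
  assumes "\<And>X. open X \<Longrightarrow> X \<noteq> {} \<Longrightarrow> \<exists>d\<in>C. d \<in> X" "U \<in> retractions" "near_extension_property C U"
  shows "extension_property U"
  using fixed_exact[OF assms] moved_exact[OF assms]
  unfolding extension_property_def fixed_realised_def moved_realised_def by simp

section \<open>A generic retraction extending a finite structure\<close>

text \<open>The point found in the Urysohn space may already belong to \<open>A\<close>. The
  inequalities at \<open>a = p\<close> then force \<open>R p = p\<close>, and nothing has to be
  added.\<close>

lemma adjoin_fixed:
  assumes "retraction_structure A dist R D"
    and p: "\<And>a. a \<in> A \<Longrightarrow> dist p (R a) \<le> dist p a" "\<And>a. a \<in> A \<Longrightarrow> D a \<le> dist p a"
  obtains R' D' where "retraction_structure (insert p A) dist R' D'" "R' p = p" "D' p = 0"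
    "\<And>x. x \<in> A \<Longrightarrow> R' x = R x" "\<And>x. x \<in> A \<Longrightarrow> D' x = D x"
proof (cases "p \<in> A")
  case True
  interpret retraction_structure A dist R D by fact
  have "R p = p" using p(1)[OF True] by simp
  then show thesis using assms(1) True D_R[OF True] by (intro that[of R D]) (auto simp: insert_absorb)
next
  case False
  from retraction_structure_insert_fixed[OF assms(1) False p] show thesis
    using False by (intro that[of "R(p := p)" "D(p := 0)"]) auto
qed

lemma adjoin_moved:
  assumes "retraction_structure A dist R D" "r \<in> A" "R r = r"
    and q: "\<And>a. a \<in> A \<Longrightarrow> dist r (R a) \<le> dist q a" "\<And>a. a \<in> A \<Longrightarrow> \<bar>\<delta> - D a\<bar> \<le> dist q a"
      "dist q r \<le> 2 * \<delta>"
  obtains R' D' where "retraction_structure (insert q A) dist R' D'" "R' q = r" "D' q = \<delta>"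
    "\<And>x. x \<in> A \<Longrightarrow> R' x = R x" "\<And>x. x \<in> A \<Longrightarrow> D' x = D x"
proof (cases "q \<in> A")
  case True
  have "R q = r" "D q = \<delta>" using q(1,2)[OF True] by simp_all
  then show thesis using assms(1) True by (intro that[of R D]) (auto simp: insert_absorb)
next
  case False
  from retraction_structure_insert_moved[OF assms(1) False assms(2,3) q] show thesis
    using False by (intro that[of "R(q := r)" "D(q := \<delta>)"]) auto
qed

section \<open>Enlarging finite structures inside the Urysohn space\<close>

definition structure_extends :: "'u::metric_space set \<Rightarrow> ('u \<Rightarrow> 'u) \<Rightarrow> ('u \<Rightarrow> real) \<Rightarrow>
    'u set \<Rightarrow> ('u \<Rightarrow> 'u) \<Rightarrow> ('u \<Rightarrow> real) \<Rightarrow> bool"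
  where "structure_extends A R D A' R' D' \<longleftrightarrow> finite A' \<and> retraction_structure A' dist R' D' \<and>
    A \<subseteq> A' \<and> (\<forall>x\<in>A. R' x = R x \<and> D' x = D x)"

lemma structure_extends_refl:
  "finite A \<Longrightarrow> retraction_structure A dist R D \<Longrightarrow> structure_extends A R D A R D"
  by (simp add: structure_extends_def)

lemma structure_extends_trans:
  "structure_extends A R D A1 R1 D1 \<Longrightarrow> structure_extends A1 R1 D1 A2 R2 D2 \<Longrightarrow>
    structure_extends A R D A2 R2 D2"
  by (auto simp: structure_extends_def subset_iff)

lemma realise_katetov:
  fixes P :: "('u::polish_space \<times> real) set"
  assumes "urysohn_space TYPE('u)" "finite A" "finite P" "P \<noteq> {}" "katetov P"
  obtains y where "\<And>a. a \<in> A \<Longrightarrow> dist y a = kat P a"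
proof (rule urysohn_realises[OF assms(1,2), of "kat P"])
  show "kat P x \<le> kat P y + dist x y" for x y by (rule kat_lipschitz[OF assms(3,4)])
  show "dist x y \<le> kat P x + kat P y" for x y by (rule dist_le_kat[OF assms(3-5)])
qed (rule that)

text \<open>The position of \<open>q\<close> is given; its image and the value of \<open>D\<close>
  have to be invented. Keeping \<open>q\<close> fixed can violate the Lipschitz condition, as
  \<open>R a\<close> may be farther from \<open>q\<close> than \<open>a\<close>. So a fixed point
  \<open>p\<close> is adjoined first to serve as the image of \<open>q\<close>.\<close>

lemma add_point:
  fixes q :: "'u::polish_space"
  assumes U: "urysohn_space TYPE('u)" and A: "finite A" "retraction_structure A dist R D"
  obtains A' R' D' where "structure_extends A R D A' R' D'" "q \<in> A'"
proof (cases "A = {}")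
  case True
  obtain R' D' where "retraction_structure (insert q A) dist R' D'"
    using adjoin_fixed[OF A(2), of q] True by (metis empty_iff)
  then show thesis using True by (intro that[of "insert q A" R' D']) (auto simp: structure_extends_def)
next
  case False
  interpret retraction_structure A dist R D by fact
  \<comment> \<open>The point \<open>p\<close> at these distances becomes the image of \<open>q\<close>: \<open>dist p (R a) \<le> dist q a\<close>.\<close>
  define P where "P = (\<lambda>a. (R a, dist q a)) ` A"
  have P: "finite P" "P \<noteq> {}" using A(1) False by (auto simp: P_def)
  have "katetov P"
    unfolding katetov_def
  proof clarify
    fix c s c' s' assume "(c, s) \<in> P" "(c', s') \<in> P"
    then obtain a a' where a: "a \<in> A" "c = R a" "s = dist q a" "a' \<in> A" "c' = R a'" "s' = dist q a'"
      by (auto simp: P_def)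
    then show "dist c c' \<le> s + s'"
      using R_lip[of a a'] dist_triangle[of a a' q] by (simp add: dist_commute)
  qed
  then obtain p where p: "\<And>x. x \<in> insert q A \<Longrightarrow> dist p x = kat P x"
    using realise_katetov[OF U _ P, of "insert q A"] A(1) by auto
  have kR: "kat P (R a) \<le> kat P a" and kD: "D a \<le> kat P a" if a: "a \<in> A" for a
  proof -
    obtain b where b: "b \<in> A" "kat P a = dist q b + dist (R b) a"
      using kat_attained[OF P, of a] by (auto simp: P_def)
    have "kat P (R a) \<le> dist q b + dist (R b) (R a)"
      using b(1) by (intro kat_le[OF P(1)]) (auto simp: P_def)
    moreover have "dist (R b) (R a) \<le> dist (R b) a"
      using R_lip[OF R_in[OF b(1)] a] R_idem[OF b(1)] by simp
    ultimately show "kat P (R a) \<le> kat P a" using b(2) by simp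
    show "D a \<le> kat P a"
      using D_lip[OF a R_in[OF b(1)]] D_R[OF b(1)] b(2) zero_le_dist[of q b] dist_commute[of a "R b"]
      by linarith
  qed
  have "dist p (R a) \<le> dist p a" "D a \<le> dist p a" if "a \<in> A" for a
    using kR[OF that] kD[OF that] p R_in that by auto
  note pA = this
  obtain R1 D1 where 1: "retraction_structure (insert p A) dist R1 D1" "R1 p = p" "D1 p = 0"
    "\<And>x. x \<in> A \<Longrightarrow> R1 x = R x" "\<And>x. x \<in> A \<Longrightarrow> D1 x = D x"
    by (rule adjoin_fixed[OF A(2), of p], rule pA(1), assumption, rule pA(2), assumption) (rule that)
  interpret B: retraction_structure "insert p A" dist R1 D1 by fact
  let ?B = "insert p A"
  have Rq: "dist p (R1 a) \<le> dist q a" if a: "a \<in> ?B" for a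
  proof (cases "a \<in> A")
    case True
    have "kat P (R a) \<le> dist q a + dist (R a) (R a)"
      using True by (intro kat_le[OF P(1)]) (auto simp: P_def)
    then show ?thesis using p[of "R a"] R_in[OF True] 1(4)[OF True] by simp
  qed (use a 1(2) in simp)
  \<comment> \<open>\<open>l x\<close> gathers the lower bounds on the value at \<open>q\<close>:
    one from the Lipschitz condition against \<open>x\<close>, one from
    \<open>dist q p \<le> 2 * \<delta>\<close>. The largest is a legitimate choice if every lower
    bound is at most every upper bound \<open>D1 y + dist q y\<close>, which is
    \<open>lu\<close>.\<close>
  define l where "l x = max (D1 x - dist q x) (dist q p / 2)" for x
  define \<delta> where "\<delta> = Max (l ` ?B)"
  have fin: "finite (l ` ?B)" "l ` ?B \<noteq> {}" using A(1) by auto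
  have lu: "l x \<le> D1 y + dist q y" if x: "x \<in> ?B" and y: "y \<in> ?B" for x y
  proof -
    have "D1 x - dist q x \<le> D1 y + dist q y"
      using B.D_lip[OF x y] dist_triangle[of x y q] by (simp add: dist_commute)
    \<comment> \<open>The way from \<open>q\<close> to \<open>p\<close> through \<open>y\<close> and
      \<open>R1 y\<close> costs \<open>dist q y\<close>, then at most \<open>2 * D1 y\<close>, then
      again at most \<open>dist q y\<close>.\<close>
    moreover have "dist q p \<le> 2 * D1 y + 2 * dist q y"
      using B.dist_R[OF y] Rq[OF y] dist_triangle[of q p "R1 y"] dist_triangle[of q "R1 y" y]
        dist_commute[of p "R1 y"] by linarith
    ultimately show ?thesis by (simp add: l_def)
  qed
  have "\<delta> \<le> D1 a + dist q a" "l a \<le> \<delta>" if "a \<in> ?B" for a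
    using lu that fin by (auto simp: \<delta>_def)
  note \<delta> = this
  obtain R2 D2 where 2: "retraction_structure (insert q ?B) dist R2 D2" "R2 q = p" "D2 q = \<delta>"
    "\<And>x. x \<in> ?B \<Longrightarrow> R2 x = R1 x" "\<And>x. x \<in> ?B \<Longrightarrow> D2 x = D1 x"
  proof (rule adjoin_moved[OF 1(1) insertI1 1(2), of q \<delta>])
    fix a assume a: "a \<in> ?B"
    show "dist p (R1 a) \<le> dist q a" by (rule Rq[OF a])
    show "\<bar>\<delta> - D1 a\<bar> \<le> dist q a" using \<delta>[OF a] by (auto simp: l_def abs_le_iff)
  next
    show "dist q p \<le> 2 * \<delta>" using \<delta>(2)[of p] by (auto simp: l_def)
  qed (rule that)
  show thesis
    using 1(4,5) 2 A(1) by (intro that[of "insert q ?B" R2 D2]) (auto simp: structure_extends_def)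
qed

lemma add_points:
  fixes Q :: "'u::polish_space set"
  assumes U: "urysohn_space TYPE('u)" and "finite Q" "finite A" "retraction_structure A dist R D"
  obtains A' R' D' where "structure_extends A R D A' R' D'" "Q \<subseteq> A'"
proof -
  have "\<exists>A' R' D'. structure_extends A R D A' R' D' \<and> Q \<subseteq> A'"
    using assms(2)
  proof induction
    case empty
    then show ?case using structure_extends_refl[OF assms(3,4)] by blast
  next
    case (insert q Q)
    then obtain A' R' D' where *: "structure_extends A R D A' R' D'" "Q \<subseteq> A'" by blast
    then have "finite A'" "retraction_structure A' dist R' D'" by (auto simp: structure_extends_def)
    then obtain A2 R2 D2 where "structure_extends A' R' D' A2 R2 D2" "q \<in> A2"
      using add_point[OF U] by blast
    with * show ?case
      using structure_extends_trans by (metis insert_subset structure_extends_def subset_trans)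
  qed
  then show thesis using that by blast
qed

lemma saturate_cong: "(\<And>c s. (c, s) \<in> P \<Longrightarrow> R' c = R c) \<Longrightarrow> saturate R' P = saturate R P"
  unfolding saturate_def by (intro arg_cong2[where f = "(\<union>)"] image_cong) auto

lemma fixed_data_cong:
  assumes "\<And>c s. (c, s) \<in> P \<Longrightarrow> R' c = R c \<and> D' c = D c"
  shows "fixed_data R' D' P = fixed_data R D P"
proof -
  have "saturate R' P = saturate R P" using assms by (intro saturate_cong) auto
  then show ?thesis using assms by (fastforce simp: fixed_data_def)
qed

lemma moved_data_cong:
  assumes "\<And>c s. (c, s) \<in> P \<Longrightarrow> R' c = R c \<and> D' c = D c" "R' b = R b"
  shows "moved_data R' D' P b \<delta> = moved_data R D P b \<delta>"
  using assms by (fastforce simp: moved_data_def)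

text \<open>Data over \<open>A\<close> involve \<open>R\<close> and \<open>D\<close> on
  \<open>A\<close> alone, so what is realised once stays realised at all later stages and in the
  completion.\<close>

lemma fixed_realised_mono:
  assumes "fixed_realised A R D P" "fst ` P \<subseteq> A" "A \<subseteq> A'" "\<And>x. x \<in> A \<Longrightarrow> R' x = R x \<and> D' x = D x"
  shows "fixed_realised A' R' D' P"
proof -
  have eq: "R' c = R c \<and> D' c = D c" if "(c, s) \<in> P" for c s using that assms by force
  have "saturate R' P = saturate R P" using eq by (intro saturate_cong) auto
  then show ?thesis
    using assms(1,3,4) fixed_data_cong[OF eq] unfolding fixed_realised_def by fastforce
qed

lemma moved_realised_mono:
  assumes "moved_realised A R D P b \<delta>" "fst ` P \<subseteq> A" "b \<in> A" "A \<subseteq> A'"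
    "\<And>x. x \<in> A \<Longrightarrow> R' x = R x \<and> D' x = D x"
  shows "moved_realised A' R' D' P b \<delta>"
proof -
  have eq: "R' c = R c \<and> D' c = D c" if "(c, s) \<in> P" for c s using that assms by force
  have b: "R' b = R b" using assms(3,5) by blast
  have "moved_data R' D' P b \<delta> = moved_data R D P b \<delta>"
    by (rule moved_data_cong) (use eq b in auto)
  then show ?thesis using assms(1,4,5) b unfolding moved_realised_def by fastforce
qed

text \<open>Saturated data are closed under \<open>R\<close> with the same bounds, and
  \<open>R\<close> is 1-Lipschitz; so the generated function does not increase from \<open>a\<close>
  to \<open>R a\<close>. The bounds \<open>D c \<le> s\<close> keep it above \<open>D\<close>. These
  are the two conditions for adjoining a fixed point.\<close>

lemma realise_fixed:
  fixes P :: "('u::polish_space \<times> real) set"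
  assumes U: "urysohn_space TYPE('u)" and A: "finite A" "retraction_structure A dist R D"
    and P: "finite P" "fst ` P \<subseteq> A"
  obtains A' R' D' where "structure_extends A R D A' R' D'" "fixed_realised A' R' D' P"
proof (cases "fixed_data R D P \<and> P \<noteq> {}")
  case False
  show thesis
  proof (cases "P = {}")
    case True
    \<comment> \<open>Empty data still ask for a fixed point in \<open>A'\<close>. Some point is
      added, and its image is one.\<close>
    show thesis
    proof (rule add_point[OF U A, of undefined])
      fix A' R' D' assume *: "structure_extends A R D A' R' D'" "undefined \<in> A'"
      interpret retraction_structure A' dist R' D' using * by (simp add: structure_extends_def)
      have "fixed_realised A' R' D' P"
        using True R_in[OF *(2)] R_idem[OF *(2)] by (auto simp: fixed_realised_def)
      with * show thesis by (intro that)
    qed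
  next
    case ne: False
    then show thesis
      using False structure_extends_refl[OF A] by (intro that[of A R D]) (auto simp: fixed_realised_def)
  qed
next
  case True
  interpret retraction_structure A dist R D by fact
  define S where "S = saturate R P"
  have S: "finite S" "S \<noteq> {}" "katetov S"
    using True P(1) by (auto simp: S_def finite_saturate saturate_def fixed_data_def)
  obtain p where p: "\<And>x. x \<in> A \<Longrightarrow> dist p x = kat S x"
    using realise_katetov[OF U A(1) S] by blast
  have SA: "c \<in> A \<and> (R c, s) \<in> S \<and> D c \<le> s" if cs: "(c, s) \<in> S" for c s
  proof -
    consider "(c, s) \<in> P" | b where "(b, s) \<in> P" "c = R b"
      using cs by (auto simp: S_def saturate_iff)
    then show ?thesis
    proof cases
      case 1
      then show ?thesis using P(2) True by (force simp: S_def saturate_iff fixed_data_def)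
    next
      case 2
      then have b: "b \<in> A" using P(2) by force
      have "0 \<le> s" using katetovD[OF S(3) cs cs] by simp
      then show ?thesis using R_in[OF b] R_idem[OF b] D_R[OF b] 2 cs by auto
    qed
  qed
  have "dist p (R a) \<le> dist p a" "D a \<le> dist p a" if a: "a \<in> A" for a
  proof -
    obtain c s where c: "(c, s) \<in> S" "kat S a = s + dist c a" using kat_attained[OF S(1,2)] .
    have "kat S (R a) \<le> s + dist (R c) (R a)" using SA[OF c(1)] by (intro kat_le[OF S(1)]) auto
    then show "dist p (R a) \<le> dist p a"
      using p[OF a] p[OF R_in[OF a]] c R_lip[of c a] SA[OF c(1)] a by simp
    show "D a \<le> dist p a"
      using p[OF a] c D_lip[of a c] SA[OF c(1)] a by (simp add: dist_commute)
  qed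
  note pA = this
  obtain R' D' where R': "retraction_structure (insert p A) dist R' D'" "R' p = p" "D' p = 0"
    "\<And>x. x \<in> A \<Longrightarrow> R' x = R x" "\<And>x. x \<in> A \<Longrightarrow> D' x = D x"
    by (rule adjoin_fixed[OF A(2), of p], rule pA(1), assumption, rule pA(2), assumption) (rule that)
  have PA: "c \<in> A" if "(c, s) \<in> P" for c s using that P(2) by force
  then have "saturate R' P = S" unfolding S_def using R'(4) by (intro saturate_cong) auto
  then have "fixed_realised (insert p A) R' D' P"
    using R'(2) p PA by (auto simp: fixed_realised_def)
  moreover have "structure_extends A R D (insert p A) R' D'"
    using R' A(1) by (auto simp: structure_extends_def)
  ultimately show thesis by (rule that[rotated])
qed

text \<open>Both lower bounds on \<open>dist q a\<close> are read off at a pair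
  \<open>(c, s)\<close> attaining \<open>kat S a\<close>: the data give them at \<open>c\<close>,
  and the 1-Lipschitz maps carry them to \<open>a\<close> at the cost of \<open>dist c a\<close>.
  The added pair yields \<open>dist q (R b) \<le> 2 * \<delta>\<close>.\<close>

lemma realise_moved:
  fixes P :: "('u::polish_space \<times> real) set"
  assumes U: "urysohn_space TYPE('u)" and A: "finite A" "retraction_structure A dist R D"
    and P: "finite P" "fst ` P \<subseteq> A" "b \<in> A"
  obtains A' R' D' where "structure_extends A R D A' R' D'" "moved_realised A' R' D' P b \<delta>"
proof (cases "moved_data R D P b \<delta>")
  case False
  then show thesis
    using structure_extends_refl[OF A] by (intro that[of A R D]) (auto simp: moved_realised_def)
next
  case True
  interpret retraction_structure A dist R D by fact
  define S where "S = insert (R b, 2 * \<delta>) P"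
  have S: "finite S" "S \<noteq> {}" "katetov S" "(R b, 2 * \<delta>) \<in> S"
    using True P(1) by (auto simp: S_def moved_data_def)
  have nn: "\<delta> \<ge> 0" using katetovD[OF S(3,4,4)] by simp
  obtain q where q: "\<And>x. x \<in> A \<Longrightarrow> dist q x = kat S x"
    using realise_katetov[OF U A(1) S(1-3)] by blast
  have SA: "c \<in> A \<and> dist (R b) (R c) \<le> s \<and> \<bar>\<delta> - D c\<bar> \<le> s" if "(c, s) \<in> S" for c s
    using that unfolding S_def
  proof (elim insertE)
    assume "(c, s) = (R b, 2 * \<delta>)"
    then show ?thesis using R_in[OF P(3)] R_idem[OF P(3)] D_R[OF P(3)] nn by simp
  next
    assume "(c, s) \<in> P"
    then show ?thesis using P(2) True by (force simp: moved_data_def)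
  qed
  have "dist (R b) (R a) \<le> dist q a" "\<bar>\<delta> - D a\<bar> \<le> dist q a" if a: "a \<in> A" for a
  proof -
    obtain c s where c: "(c, s) \<in> S" "kat S a = s + dist c a" using kat_attained[OF S(1,2)] .
    note cA = SA[OF c(1), THEN conjunct1]
    show "dist (R b) (R a) \<le> dist q a"
      using q[OF a] c(2) R_lip[OF cA a] SA[OF c(1)] dist_triangle[of "R b" "R a" "R c"] by simp
    show "\<bar>\<delta> - D a\<bar> \<le> dist q a"
      using q[OF a] c(2) D_lip[OF a cA] D_lip[OF cA a] SA[OF c(1)] by (simp add: dist_commute abs_le_iff)
  qed
  note qA = this
  have qb: "dist q (R b) \<le> 2 * \<delta>"
    using q[OF R_in[OF P(3)]] kat_le[OF S(1,4), of "R b"] by simp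
  obtain R' D' where R': "retraction_structure (insert q A) dist R' D'" "R' q = R b" "D' q = \<delta>"
    "\<And>x. x \<in> A \<Longrightarrow> R' x = R x" "\<And>x. x \<in> A \<Longrightarrow> D' x = D x"
    by (rule adjoin_moved[OF A(2) R_in[OF P(3)] R_idem[OF P(3)], of q \<delta>],
        rule qA(1), assumption, rule qA(2), assumption, rule qb) (rule that)
  have PA: "c \<in> A" if "(c, s) \<in> P" for c s using that P(2) by force
  have "moved_realised (insert q A) R' D' P b \<delta>"
    using R'(2,3) R'(4)[OF P(3)] q PA by (auto simp: moved_realised_def S_def)
  moreover have "structure_extends A R D (insert q A) R' D'"
    using R' A(1) by (auto simp: structure_extends_def)
  ultimately show thesis by (rule that[rotated])
qed

lemma realise_both:
  fixes P :: "('u::polish_space \<times> real) set"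
  assumes U: "urysohn_space TYPE('u)" and A: "finite A" "retraction_structure A dist R D"
    and P: "finite P"
  obtains A' R' D' where "structure_extends A R D A' R' D'" "insert b (fst ` P) \<subseteq> A'"
    "fixed_realised A' R' D' P" "moved_realised A' R' D' P b \<delta>"
proof -
  have "finite (insert b (fst ` P))" using P by simp
  then obtain A1 R1 D1 where 1: "structure_extends A R D A1 R1 D1" "insert b (fst ` P) \<subseteq> A1"
    using add_points[OF U _ A] by blast
  have e1: "finite A1" "retraction_structure A1 dist R1 D1" "fst ` P \<subseteq> A1" "b \<in> A1"
    using 1 by (auto simp: structure_extends_def)
  obtain A2 R2 D2 where 2: "structure_extends A1 R1 D1 A2 R2 D2" "fixed_realised A2 R2 D2 P"
    using realise_fixed[OF U e1(1,2) P e1(3)] .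
  have e2: "finite A2" "retraction_structure A2 dist R2 D2" "fst ` P \<subseteq> A2" "b \<in> A2"
    using 2 e1 by (auto simp: structure_extends_def)
  obtain A3 R3 D3 where 3: "structure_extends A2 R2 D2 A3 R3 D3" "moved_realised A3 R3 D3 P b \<delta>"
    using realise_moved[OF U e2(1,2) P e2(3,4)] .
  show thesis
  proof (rule that)
    show "structure_extends A R D A3 R3 D3" using 1(1) 2(1) 3(1) structure_extends_trans by blast
    show "insert b (fst ` P) \<subseteq> A3" using e2(3,4) 3(1) by (auto simp: structure_extends_def)
    show "fixed_realised A3 R3 D3 P"
      using 3(1) by (intro fixed_realised_mono[OF 2(2) e2(3)]) (auto simp: structure_extends_def)
  qed (rule 3(2))
qed

section \<open>Unions and completions of structures\<close>

lemma retraction_structure_cong: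
  assumes "retraction_structure A d R D" "\<And>x. x \<in> A \<Longrightarrow> R' x = R x" "\<And>x. x \<in> A \<Longrightarrow> D' x = D x"
  shows "retraction_structure A d R' D'"
proof -
  interpret retraction_structure A d R D by fact
  show ?thesis
    by unfold_locales (simp_all add: assms(2,3) R_in R_lip R_idem D_lip D_R dist_R)
qed

lemma retraction_structure_Union:
  assumes "incseq Fs" "\<And>n. retraction_structure (Fs n) dist R D"
  shows "retraction_structure (\<Union>n. Fs n) dist R D"
proof -
  have pair: "\<exists>k. x \<in> Fs k \<and> y \<in> Fs k" if xy: "x \<in> (\<Union>n. Fs n)" "y \<in> (\<Union>n. Fs n)" for x y
  proof -
    obtain m n where "x \<in> Fs m" "y \<in> Fs n" using xy by blast
    then show ?thesis
      using incseqD[OF assms(1), of m "max m n"] incseqD[OF assms(1), of n "max m n"] by auto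
  qed
  interpret M: Metric_space "\<Union>n. Fs n" dist by (rule Metric_space_dist)
  show ?thesis
  proof
    fix x y assume "x \<in> (\<Union>n. Fs n)" "y \<in> (\<Union>n. Fs n)"
    then obtain k where k: "x \<in> Fs k" "y \<in> Fs k" using pair by blast
    interpret retraction_structure "Fs k" dist R D by (rule assms(2))
    show "dist (R x) (R y) \<le> dist x y" "D x \<le> D y + dist x y" using R_lip D_lip k by auto
  next
    fix x assume "x \<in> (\<Union>n. Fs n)"
    then obtain k where k: "x \<in> Fs k" by blast
    interpret retraction_structure "Fs k" dist R D by (rule assms(2))
    show "R x \<in> (\<Union>n. Fs n)" "R (R x) = R x" "D (R x) = 0" "dist x (R x) \<le> 2 * D x"
      using R_in[OF k] R_idem[OF k] D_R[OF k] dist_R[OF k] by auto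
  qed
qed

text \<open>The maps extend by uniform continuity, and the axioms, being equations and non-strict
  inequalities, survive limits. At this point \<open>E\<close> is just an extension of
  \<open>D\<close>; that it is the distance to the range of \<open>U\<close> requires more.\<close>

lemma retraction_structure_completion:
  fixes A :: "'u::complete_space set"
  assumes "retraction_structure A dist R D" "closure A = UNIV"
  obtains U E where "retraction_structure UNIV dist U E" "\<And>x. x \<in> A \<Longrightarrow> U x = R x"
    "\<And>x. x \<in> A \<Longrightarrow> E x = D x"
proof -
  interpret retraction_structure A dist R D by fact
  have "uniformly_continuous_on A R"
    unfolding uniformly_continuous_on_def using R_lip le_less_trans by metis
  then obtain U where U: "uniformly_continuous_on UNIV U" "\<And>x. x \<in> A \<Longrightarrow> R x = U x"
    using uniformly_continuous_on_extension_on_closure[of A R] assms(2) by metis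
  have "dist (D x) (D y) \<le> dist x y" if "x \<in> A" "y \<in> A" for x y
    using D_lip[OF that] D_lip[OF that(2,1)] by (simp add: dist_real_def dist_commute abs_le_iff)
  then have "uniformly_continuous_on A D"
    unfolding uniformly_continuous_on_def using le_less_trans by metis
  then obtain E where E: "uniformly_continuous_on UNIV E" "\<And>x. x \<in> A \<Longrightarrow> D x = E x"
    using uniformly_continuous_on_extension_on_closure[of A D] assms(2) by metis
  have lim: "(\<lambda>n. U (z n)) \<longlonglongrightarrow> U x" "(\<lambda>n. E (z n)) \<longlonglongrightarrow> E x" if "z \<longlonglongrightarrow> x" for z x
    by (rule continuous_on_tendsto_compose[OF uniformly_continuous_imp_continuous that, OF U(1)];
        simp)
      (rule continuous_on_tendsto_compose[OF uniformly_continuous_imp_continuous that, OF E(1)];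
        simp)
  have approx: "\<exists>z. (\<forall>n. z n \<in> A) \<and> z \<longlonglongrightarrow> x" for x
    using closure_sequential[of x A] assms(2) by auto
  interpret UM: Metric_space "UNIV :: 'u set" dist by (rule Metric_space_dist)
  have "retraction_structure UNIV dist U E"
  proof
    fix x y
    obtain z where z: "\<And>n. z n \<in> A" "z \<longlonglongrightarrow> x" using approx by blast
    obtain w where w: "\<And>n. w n \<in> A" "w \<longlonglongrightarrow> y" using approx by blast
    note tl = tendsto_le[OF sequentially_bot, OF _ _ always_eventually, OF _ _ allI]
    show "dist (U x) (U y) \<le> dist x y"
      by (rule tl[OF tendsto_dist[OF z(2) w(2)] tendsto_dist[OF lim(1)[OF z(2)] lim(1)[OF w(2)]]])
        (use R_lip[OF z(1) w(1)] U(2) z(1) w(1) in simp)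
    show "E x \<le> E y + dist x y"
      by (rule tl[OF tendsto_add[OF lim(2)[OF w(2)] tendsto_dist[OF z(2) w(2)]] lim(2)[OF z(2)]])
        (use D_lip[OF z(1) w(1)] E(2) z(1) w(1) in simp)
    show "dist x (U x) \<le> 2 * E x"
      by (rule tl[OF tendsto_mult[OF tendsto_const lim(2)[OF z(2)]] tendsto_dist[OF z(2) lim(1)[OF z(2)]]])
        (use dist_R[OF z(1)] U(2) E(2) z(1) in simp)
    have UU: "U (U (z n)) = U (z n)" "E (U (z n)) = 0" for n
      using R_in[OF z(1)] R_idem[OF z(1)] D_R[OF z(1)] U(2) E(2) z(1) by metis+
    show "U (U x) = U x"
      using LIMSEQ_unique[OF lim(1)[OF lim(1)[OF z(2)]]] lim(1)[OF z(2)] UU(1) by simp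
    show "E (U x) = 0"
      using LIMSEQ_unique[OF lim(2)[OF lim(1)[OF z(2)]]] UU(2) by simp
  qed simp
  then show thesis using U(2) E(2) by (intro that) auto
qed

text \<open>\<open>E\<close> never exceeds the distance to the range, being 1-Lipschitz and 0 there.
  The converse needs fixed points nearly as close as \<open>E\<close> allows, and by continuity it
  suffices to have them for the points of a dense set.\<close>

lemma range_dist_eqI:
  assumes "retraction_structure UNIV dist U E"
    and C: "\<And>X. open X \<Longrightarrow> X \<noteq> {} \<Longrightarrow> \<exists>d\<in>C. d \<in> X"
    and wit: "\<And>c e. c \<in> C \<Longrightarrow> e > 0 \<Longrightarrow> \<exists>p. U p = p \<and> dist p c \<le> E c + e"
  shows "range_dist U = E"
proof
  fix x
  interpret retraction_structure UNIV dist U E by fact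
  have "E x \<le> range_dist U x"
    unfolding range_dist_def infdist_def
    using D_lip[of x] D_R by (auto intro!: cINF_greatest) (metis add_0)
  moreover have "range_dist U x \<le> E x + e" if e: "e > 0" for e
  proof -
    obtain c where c: "c \<in> C" "dist x c < e / 4"
      using C[of "ball x (e / 4)"] e by force
    obtain p where p: "U p = p" "dist p c \<le> E c + e / 4" using wit[OF c(1), of "e / 4"] e by auto
    have "range_dist U x \<le> dist x p"
      unfolding range_dist_def using p(1) by (intro infdist_le) (metis rangeI)
    then show ?thesis
      using p(2) c(2) dist_triangle[of x p c] D_lip[of c x] e by (simp add: dist_commute)
  qed
  ultimately show "range_dist U x = E x" by (meson antisym field_le_epsilon)
qed

lemma countable_rational_data: "countable C \<Longrightarrow> countable (rational_data C)"
  unfolding rational_data_def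
  by (rule countable_Collect_finite_subset) (simp add: countable_SIGMA countable_rat)

lemma generic_retraction:
  fixes C :: "'u::polish_space set"
  assumes Ury: "urysohn_space TYPE('u)"
    and C: "countable C" "\<And>X. open X \<Longrightarrow> X \<noteq> {} \<Longrightarrow> \<exists>d\<in>C. d \<in> X"
    and A: "finite A" "retraction_structure A dist R D"
  obtains U where "U \<in> retractions" "near_extension_property C U"
    "\<And>x. x \<in> A \<Longrightarrow> U x = R x \<and> range_dist U x = D x"
proof -
  define T where "T = rational_data C \<times> C \<times> (\<rat> :: real set)"
  have "C \<noteq> {}" using C(2)[of UNIV] by auto
  then have T: "countable T" "T \<noteq> {}"
    using countable_rational_data[OF C(1)] C(1) by (auto simp: T_def countable_rat rational_data_def)
  define t where "t = from_nat_into T"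
  have t: "range t = T" unfolding t_def by (rule range_from_nat_into[OF T(2,1)])
  define Inv where "Inv F i \<longleftrightarrow> finite F \<and> retraction_structure F dist (fst \<circ> i) (snd \<circ> i)"
    for F :: "'u set" and i :: "'u \<Rightarrow> 'u \<times> real"
  define Goal where "Goal n F i \<longleftrightarrow> (case t n of (P, b, \<delta>) \<Rightarrow> insert b (fst ` P) \<subseteq> F \<and>
    fixed_realised F (fst \<circ> i) (snd \<circ> i) P \<and> moved_realised F (fst \<circ> i) (snd \<circ> i) P b \<delta>)"
    for n and F :: "'u set" and i :: "'u \<Rightarrow> 'u \<times> real"
  obtain Fs g where Fs: "Fs 0 = A" "\<And>x. x \<in> A \<Longrightarrow> g x = (R x, D x)" "\<And>n. Inv (Fs n) g" "incseq Fs"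
    "\<And>n. Goal n (Fs (Suc n)) g"
  proof (rule extension_chain[of Inv A "\<lambda>x. (R x, D x)" Goal])
    show "Inv A (\<lambda>x. (R x, D x))" using A by (simp add: Inv_def comp_def)
    show "\<exists>F' i'. Inv F' i' \<and> F \<subseteq> F' \<and> (\<forall>x\<in>F. i' x = i x) \<and> Goal n F' i'" if I: "Inv F i" for n F i
    proof -
      obtain P b \<delta> where tn: "t n = (P, b, \<delta>)" by (cases "t n")
      have "t n \<in> T" using t by auto
      then have P: "finite P" using tn by (auto simp: T_def rational_data_def)
      have F: "finite F" "retraction_structure F dist (fst \<circ> i) (snd \<circ> i)" using I by (auto simp: Inv_def)
      obtain F' R' D' where F': "structure_extends F (fst \<circ> i) (snd \<circ> i) F' R' D'"
        "insert b (fst ` P) \<subseteq> F'" "fixed_realised F' R' D' P" "moved_realised F' R' D' P b \<delta>"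
        by (rule realise_both[OF Ury F P])
      show ?thesis
        using F' by (intro exI[of _ F'] exI[of _ "\<lambda>x. (R' x, D' x)"])
          (auto simp: Inv_def Goal_def tn comp_def structure_extends_def)
    qed
    show "Inv F i'" if "Inv F i" "\<forall>x\<in>F. i' x = i x" for F i i'
      using that retraction_structure_cong[of F dist "fst \<circ> i" "snd \<circ> i" "fst \<circ> i'" "snd \<circ> i'"]
      by (simp add: Inv_def)
    show "Goal n F i'" if "Inv F i" "Goal n F i" "\<forall>x\<in>F. i' x = i x" for n F i i'
      using that(2,3) unfolding Goal_def
      by (auto split: prod.splits intro: fixed_realised_mono moved_realised_mono)
  qed blast
  let ?F = "\<Union>n. Fs n"
  have "retraction_structure (Fs n) dist (fst \<circ> g) (snd \<circ> g)" for n using Fs(3) by (simp add: Inv_def)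
  note S = retraction_structure_Union[OF Fs(4) this]
  have goal: "insert b (fst ` P) \<subseteq> ?F" "fixed_realised ?F (fst \<circ> g) (snd \<circ> g) P"
    "moved_realised ?F (fst \<circ> g) (snd \<circ> g) P b \<delta>"
    if Pb: "P \<in> rational_data C" "b \<in> C" "\<delta> \<in> \<rat>" for P b \<delta>
  proof -
    have "(P, b, \<delta>) \<in> range t" using Pb unfolding t by (simp add: T_def)
    then obtain n where n: "t n = (P, b, \<delta>)" by (metis imageE)
    have G: "insert b (fst ` P) \<subseteq> Fs (Suc n)" "fixed_realised (Fs (Suc n)) (fst \<circ> g) (snd \<circ> g) P"
      "moved_realised (Fs (Suc n)) (fst \<circ> g) (snd \<circ> g) P b \<delta>"
      using Fs(5)[of n] by (auto simp: Goal_def n)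
    then show "insert b (fst ` P) \<subseteq> ?F" by blast
    show "fixed_realised ?F (fst \<circ> g) (snd \<circ> g) P"
      by (rule fixed_realised_mono[OF G(2)]) (use G(1) in auto)
    show "moved_realised ?F (fst \<circ> g) (snd \<circ> g) P b \<delta>"
      by (rule moved_realised_mono[OF G(3)]) (use G(1) in auto)
  qed
  have "{} \<in> rational_data C" by (simp add: rational_data_def)
  then have CF: "C \<subseteq> ?F" using goal(1)[of "{}" _ 0] by auto
  have "closure ?F = UNIV"
  proof (rule ccontr)
    assume "closure ?F \<noteq> UNIV"
    then have "- closure ?F \<noteq> {}" by auto
    then obtain c where "c \<in> C" "c \<in> - closure ?F" using C(2)[of "- closure ?F"] by auto
    then show False using CF closure_subset[of ?F] by auto
  qed
  then obtain U E where U: "retraction_structure UNIV dist U E"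
    "\<And>x. x \<in> ?F \<Longrightarrow> U x = (fst \<circ> g) x" "\<And>x. x \<in> ?F \<Longrightarrow> E x = (snd \<circ> g) x"
    using retraction_structure_completion[OF S] by metis
  interpret retraction_structure UNIV dist U E by fact
  have fixU: "fixed_realised UNIV U E P" if "P \<in> rational_data C" for P
  proof -
    obtain b where "b \<in> C" using \<open>C \<noteq> {}\<close> by blast
    note G = goal[OF that this Rats_0]
    show ?thesis by (rule fixed_realised_mono[OF G(2)]) (use G(1) U(2,3) in auto)
  qed
  have movU: "moved_realised UNIV U E P b \<delta>" if "P \<in> rational_data C" "b \<in> C" "\<delta> \<in> \<rat>" for P b \<delta>
    by (rule moved_realised_mono[OF goal(3)[OF that]]) (use goal(1)[OF that] U(2,3) in auto)
  \<comment> \<open>A single pair \<open>(c, s)\<close> with \<open>s\<close> rational and just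
    above \<open>E c\<close> asks for such a fixed point. Its consistency with
    \<open>(U c, s)\<close> follows from \<open>dist c (U c) \<le> 2 * E c\<close>: here the factor
    2 in the axiom \<open>dist_R\<close> pays off.\<close>
  have wit: "\<exists>p. U p = p \<and> dist p c \<le> E c + e" if c: "c \<in> C" and e: "e > 0" for c e
  proof -
    obtain s where s: "s \<in> \<rat>" "E c < s" "s < E c + e"
      using Rats_dense_in_real[of "E c" "E c + e"] e by auto
    let ?P = "{(c, s)}"
    have "?P \<in> rational_data C" using c s by (simp add: rational_data_def)
    moreover have "0 \<le> s" "dist c (U c) \<le> 2 * s" using dist_R[of c] s(2) zero_le_dist[of c "U c"]
      by (simp_all del: zero_le_dist)
    then have "fixed_data U E ?P"
      using s(2) by (auto simp: fixed_data_def katetov_def saturate_def dist_commute)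
    ultimately obtain y where y: "U y = y" "dist y c = kat (saturate U ?P) c"
      using fixU[of ?P] by (auto simp: fixed_realised_def)
    have "kat (saturate U ?P) c \<le> s + dist c c" by (rule kat_le) (auto simp: saturate_def)
    with y s show ?thesis by (intro exI[of _ y]) simp
  qed
  have E: "range_dist U = E" by (rule range_dist_eqI[OF U(1) C(2) wit])
  show thesis
  proof
    show "U \<in> retractions"
      using R_lip R_idem by (auto simp: retractions_def lipschitz_retraction_on_def)
    show "near_extension_property C U"
      unfolding near_extension_property_def
    proof (intro allI impI ballI conjI)
      fix e \<delta> :: real and P b assume e: "e > 0" and P: "P \<in> rational_data C"
      show "fixed_near U e P"
        by (rule fixed_realised_imp_near[OF _ e]) (use fixU[OF P] E in simp)
      assume "b \<in> C" "\<delta> \<in> \<rat>"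
      from movU[OF P this] show "moved_near U e P b \<delta>"
        by (intro moved_realised_imp_near[OF _ e]) (simp add: E)
    qed
    fix x assume x: "x \<in> A"
    then have "x \<in> ?F" using Fs(1) by blast
    then show "U x = R x \<and> range_dist U x = D x" using U(2,3) Fs(2)[OF x] E by simp
  qed
qed

section \<open>Universal ultrahomogeneous retractions have the extension property\<close>

lemma universal_imp_embedding:
  fixes V W :: "'u::polish_space \<Rightarrow> 'u"
  assumes "universal_retraction W" "V \<in> retractions"
  obtains j where "structure_embedding dist V (range_dist V) W UNIV j"
proof -
  obtain C :: "'u set" where C: "countable C" "\<And>X. open X \<Longrightarrow> X \<noteq> {} \<Longrightarrow> \<exists>d\<in>C. d \<in> X"
    using countable_dense_setE by blast
  have "euclidean closure_of C = UNIV"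
    using C(2) by (auto simp: closure_of_def)
  then have "separable_space (euclidean :: 'u topology)"
    using C(1) by (auto simp: separable_space_def)
  then have sep: "separable_space (Metric_space.mtopology UNIV (dist :: 'u \<Rightarrow> 'u \<Rightarrow> real))"
    by (simp add: mtopology_is_euclidean)
  have lip: "lipschitz_retraction_on UNIV dist V" using assms(2) by (simp add: retractions_def)
  obtain i where "isometric_on UNIV dist i" "\<And>x. x \<in> UNIV \<Longrightarrow> i (V x) = W (i x)"
    "\<And>x. x \<in> UNIV \<Longrightarrow> range_dist_on UNIV dist V x = range_dist W (i x)"
    using universal_retraction_embedding[OF assms(1) Metric_space_dist sep lip] by metis
  then have "structure_embedding dist V (range_dist V) W UNIV i"
    by (simp add: structure_embedding_def range_dist_on_UNIV)
  then show thesis by (rule that)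
qed

lemma structure_embedding_UNIV:
  "structure_embedding dist V (range_dist V) W UNIV h \<longleftrightarrow>
    (\<forall>x y. dist (h x) (h y) = dist x y) \<and> (\<forall>x. h (V x) = W (h x) \<and> range_dist V x = range_dist W (h x))"
  by (auto simp: structure_embedding_def isometric_on_def)

lemma saturate_image:
  "(\<And>x. h (V x) = W (h x)) \<Longrightarrow> saturate W (map_prod h id ` P) = map_prod h id ` saturate V P"
  by (simp add: saturate_def image_Un image_image map_prod_def case_prod_unfold)

lemma katetov_image:
  "(\<And>x y. dist (h x) (h y) = dist x y) \<Longrightarrow> katetov (map_prod h id ` P) = katetov P"
  by (fastforce simp: katetov_def)

lemma fixed_data_image:
  assumes "structure_embedding dist V (range_dist V) W UNIV h"
  shows "fixed_data W (range_dist W) (map_prod h id ` P) = fixed_data V (range_dist V) P"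
proof -
  note h = assms[unfolded structure_embedding_UNIV]
  have "katetov (saturate W (map_prod h id ` P)) = katetov (saturate V P)"
    using h saturate_image[of h V W P] katetov_image[of h "saturate V P"] by simp
  then show ?thesis using h by (auto simp: fixed_data_def)
qed

lemma moved_data_image:
  assumes "structure_embedding dist V (range_dist V) W UNIV h"
  shows "moved_data W (range_dist W) (map_prod h id ` P) (h b) \<delta> = moved_data V (range_dist V) P b \<delta>"
proof -
  note h = assms[unfolded structure_embedding_UNIV]
  have "insert (W (h b), 2 * \<delta>) (map_prod h id ` P) = map_prod h id ` insert (V b, 2 * \<delta>) P"
    using h by simp
  then have "katetov (insert (W (h b), 2 * \<delta>) (map_prod h id ` P)) = katetov (insert (V b, 2 * \<delta>) P)"
    using h katetov_image[of h "insert (V b, 2 * \<delta>) P"] by simp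
  moreover have "dist (W (h b)) (W (h c)) = dist (V b) (V c)" for c using h by metis
  ultimately show ?thesis using h by (simp add: moved_data_def case_prod_unfold)
qed

text \<open>\<open>k\<close> is an isomorphism from \<open>A\<close> onto its image, so its inverse
  there is a finite partial isomorphism of \<open>U\<close> and extends to the whole space. The
  extension carries points realised over the image of \<open>A\<close> to points realised over
  \<open>A\<close>.\<close>

lemma ultrahomogeneous_pull_back:
  assumes U: "U \<in> retractions" "ultrahomogeneous_retraction U"
    and k: "structure_embedding dist U (range_dist U) U UNIV k"
    and A: "finite A" "U ` A \<subseteq> A"
  obtains I where "structure_embedding dist U (range_dist U) U UNIV I" "\<And>c. c \<in> A \<Longrightarrow> I (k c) = c"
proof -
  have kA: "structure_embedding dist U (range_dist U) U A k"
    using k by (auto simp: structure_embedding_def isometric_on_def)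
  note inv = structure_embedding_inverse[OF kA A(2)]
  have "inv_into A k ` k ` A = A" using inv(3) by force
  then obtain I where "isometric_on UNIV dist I" "\<forall>x\<in>k ` A. I x = inv_into A k x"
      "\<forall>x. I (U x) = U (I x) \<and> range_dist U x = range_dist U (I x)"
    using U(2)[unfolded ultrahomogeneous_retraction_def, rule_format, of "k ` A" A "inv_into A k"]
      inv(1,2) A by (auto simp: structure_embedding_def)
  then show thesis using inv(3) by (intro that[of I]) (auto simp: structure_embedding_def)
qed

text \<open>Universality gives no control over where given points go. Data realised in
  \<open>W\<close> and mapped back by \<open>i\<close> are realised over the points
  \<open>i (j c)\<close>; moving these to \<open>c\<close> is the task of ultrahomogeneity.\<close>

lemma universal_ultrahomogeneous_imp_extension_property:
  fixes U W :: "'u::polish_space \<Rightarrow> 'u"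
  assumes U: "U \<in> retractions" "universal_retraction U" "ultrahomogeneous_retraction U"
    and W: "W \<in> retractions" "extension_property W"
  shows "extension_property U"
proof -
  obtain j where j: "structure_embedding dist U (range_dist U) W UNIV j"
    using universal_imp_embedding[OF extension_property_imp_universal[OF W] U(1)] .
  obtain i where i: "structure_embedding dist W (range_dist W) U UNIV i"
    using universal_imp_embedding[OF U(2) W(1)] .
  note j' = j[unfolded structure_embedding_UNIV] and i' = i[unfolded structure_embedding_UNIV]
  have ij: "structure_embedding dist U (range_dist U) U UNIV (\<lambda>x. i (j x))"
    using j' i' by (auto simp: structure_embedding_UNIV)
  have idem: "U (U x) = U x" for x using retraction_structure.R_idem[OF retraction_structure_UNIV[OF U(1)]] by simp
  have pull: "\<exists>I. structure_embedding dist U (range_dist U) U UNIV I \<and> (\<forall>c\<in>B. I (i (j c)) = c)"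
    if "finite B" for B
  proof -
    \<comment> \<open>Ultrahomogeneity speaks of sets closed under \<open>U\<close>. Adding the
      images once is enough because \<open>U\<close> is idempotent.\<close>
    have "finite (B \<union> U ` B)" "U ` (B \<union> U ` B) \<subseteq> B \<union> U ` B" using that idem by auto
    then obtain I where "structure_embedding dist U (range_dist U) U UNIV I"
      "\<And>c. c \<in> B \<union> U ` B \<Longrightarrow> I (i (j c)) = c"
      using ultrahomogeneous_pull_back[OF U(1,3) ij] by metis
    then show ?thesis by blast
  qed
  have kat_j: "kat (map_prod j id ` Q) (j c) = kat Q c" for Q c
    using j' by (intro kat_isometric_image) auto
  show ?thesis
    unfolding extension_property_def fixed_realised_def moved_realised_def
  proof (intro conjI allI impI)
    fix P :: "('u \<times> real) set"
    assume P: "finite P" "fixed_data U (range_dist U) P"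
    let ?P = "map_prod j id ` P"
    have "finite ?P" "fixed_data W (range_dist W) ?P" using P fixed_data_image[OF j] by auto
    then obtain y where y: "W y = y" "\<forall>(c, s)\<in>?P. dist y c = kat (saturate W ?P) c"
      using W(2) unfolding extension_property_def fixed_realised_def by meson
    have sat: "saturate W ?P = map_prod j id ` saturate U P"
      by (rule saturate_image) (use j' in simp)
    obtain I where I: "structure_embedding dist U (range_dist U) U UNIV I" "\<forall>c\<in>fst ` P. I (i (j c)) = c"
      using pull[of "fst ` P"] P(1) by auto
    note I' = I(1)[unfolded structure_embedding_UNIV]
    have "dist (I (i y)) c = kat (saturate U P) c" if c: "(c, s) \<in> P" for c s
    proof -
      have "I (i (j c)) = c" using I(2) c by force
      then have "dist (I (i y)) c = dist y (j c)" using I' i' by metis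
      moreover have "dist y (j c) = kat (saturate W ?P) (j c)" using y(2) c by auto
      ultimately show ?thesis by (simp only: sat kat_j)
    qed
    moreover have "U (I (i y)) = I (i y)" using I' i' y(1) by metis
    ultimately show "\<exists>y\<in>UNIV. U y = y \<and> (\<forall>(c, s)\<in>P. dist y c = kat (saturate U P) c)" by blast
  next
    fix P :: "('u \<times> real) set" and b \<delta>
    assume P: "finite P" "moved_data U (range_dist U) P b \<delta>"
    let ?P = "map_prod j id ` P"
    have "finite ?P" "moved_data W (range_dist W) ?P (j b) \<delta>" using P moved_data_image[OF j] by auto
    then obtain y where y: "W y = W (j b)" "range_dist W y = \<delta>"
      "\<forall>(c, s)\<in>?P. dist y c = kat (insert (W (j b), 2 * \<delta>) ?P) c"
      using W(2) unfolding extension_property_def moved_realised_def by meson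
    have ins: "insert (W (j b), 2 * \<delta>) ?P = map_prod j id ` insert (U b, 2 * \<delta>) P" using j' by simp
    \<comment> \<open>\<open>U b\<close> joins the points to be restored: \<open>U\<close> sends
      \<open>i y\<close> to \<open>i (j (U b))\<close>, and \<open>I\<close> has to return this to
      \<open>U b\<close>.\<close>
    obtain I where I: "structure_embedding dist U (range_dist U) U UNIV I"
      "\<forall>c\<in>insert (U b) (fst ` P). I (i (j c)) = c"
      using pull[of "insert (U b) (fst ` P)"] P(1) by auto
    note I' = I(1)[unfolded structure_embedding_UNIV]
    have "dist (I (i y)) c = kat (insert (U b, 2 * \<delta>) P) c" if c: "(c, s) \<in> P" for c s
    proof -
      have "I (i (j c)) = c" using I(2) c by force
      then have "dist (I (i y)) c = dist y (j c)" using I' i' by metis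
      moreover have "dist y (j c) = kat (insert (W (j b), 2 * \<delta>) ?P) (j c)" using y(3) c by auto
      ultimately show ?thesis by (simp only: ins kat_j)
    qed
    moreover have "U (I (i y)) = I (i (j (U b)))" using I' i' j' y(1) by metis
    moreover have "range_dist U (I (i y)) = \<delta>" using I' i' y(2) by metis
    ultimately show "\<exists>y\<in>UNIV. U y = U b \<and> range_dist U y = \<delta> \<and>
      (\<forall>(c, s)\<in>P. dist y c = kat (insert (U b, 2 * \<delta>) P) c)"
      using I(2) by (intro bexI[of _ "I (i y)"]) auto
  qed
qed

section \<open>Open conditions on retractions\<close>

lemma tendsto_Min:
  fixes f :: "'i \<Rightarrow> 'a \<Rightarrow> 'b::linorder_topology"
  assumes "finite I" "I \<noteq> {}" "\<And>i. i \<in> I \<Longrightarrow> (f i \<longlongrightarrow> l i) F"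
  shows "((\<lambda>x. Min ((\<lambda>i. f i x) ` I)) \<longlongrightarrow> Min (l ` I)) F"
  using assms by (induction rule: finite_ne_induct) (simp_all add: tendsto_min)

lemma eventually_nhdsin_pr_nhd:
  assumes "U \<in> retractions" "finite X" "e > 0"
  shows "eventually (\<lambda>R. R \<in> pr_nhd U X e) (nhdsin pr_topology U)"
  unfolding eventually_nhdsin using assms openin_pr_nhd[OF assms(2), of U e]
  by (auto simp: pr_nhd_def)

lemma tendsto_pr:
  assumes "U \<in> retractions"
  shows "((\<lambda>R. R x) \<longlongrightarrow> U x) (nhdsin pr_topology U)"
    "((\<lambda>R. range_dist R x) \<longlongrightarrow> range_dist U x) (nhdsin pr_topology U)"
proof -
  have ev: "eventually (\<lambda>R. R \<in> pr_nhd U {x} e) (nhdsin pr_topology U)" if "e > 0" for e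
    by (rule eventually_nhdsin_pr_nhd[OF assms _ that]) simp
  show "((\<lambda>R. R x) \<longlongrightarrow> U x) (nhdsin pr_topology U)"
    by (rule tendstoI, rule eventually_mono[OF ev]) (auto simp: pr_nhd_def)
  show "((\<lambda>R. range_dist R x) \<longlongrightarrow> range_dist U x) (nhdsin pr_topology U)"
    by (rule tendstoI, rule eventually_mono[OF ev])
      (auto simp: pr_nhd_def dist_real_def abs_minus_commute)
qed

lemma openin_pr_topologyI:
  assumes "\<And>U. U \<in> retractions \<Longrightarrow> Q U \<Longrightarrow> eventually Q (nhdsin pr_topology U)"
  shows "openin pr_topology {U \<in> retractions. Q U}"
proof (subst openin_subopen, clarify)
  fix U assume U: "U \<in> retractions" "Q U"
  then obtain T where "openin pr_topology T" "U \<in> T" "\<forall>R\<in>T. Q R"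
    using assms[OF U] by (auto simp: eventually_nhdsin topspace_pr_topology)
  moreover have "T \<subseteq> retractions"
    using openin_subset[OF \<open>openin pr_topology T\<close>] by (simp add: topspace_pr_topology)
  ultimately show "\<exists>T. openin pr_topology T \<and> U \<in> T \<and> T \<subseteq> {U \<in> retractions. Q U}" by blast
qed

lemma tendsto_kat_saturate:
  assumes "U \<in> retractions" "finite P" "P \<noteq> {}"
  shows "((\<lambda>R. kat (saturate R P) x) \<longlongrightarrow> kat (saturate U P) x) (nhdsin pr_topology U)"
proof -
  have eq: "kat (saturate R P) x = min (kat P x) (Min ((\<lambda>p. snd p + dist (R (fst p)) x) ` P))" for R
    unfolding kat_def saturate_def image_Un using assms(2,3)
    by (subst Min_Un) (auto simp: image_image case_prod_unfold)
  show ?thesis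
    unfolding eq
    by (intro tendsto_min tendsto_const tendsto_Min[OF assms(2,3)] tendsto_add tendsto_dist
        tendsto_pr(1)[OF assms(1)])
qed

text \<open>If the data are admissible for \<open>U\<close>, the witness \<open>y\<close> for
  \<open>U\<close> works for all nearby \<open>R\<close>, since the strict inequalities involve
  quantities continuous in \<open>R\<close>. If not, some non-strict inequality is violated and
  remains so nearby, and the implication holds there vacuously.\<close>

lemma openin_fixed_near:
  assumes "finite P"
  shows "openin pr_topology {U \<in> retractions. fixed_near U e P}"
proof (rule openin_pr_topologyI)
  fix U :: "'a \<Rightarrow> 'a" assume U: "U \<in> retractions" and near: "fixed_near U e P"
  note lim = tendsto_pr[OF U]
  show "eventually (\<lambda>U. fixed_near U e P) (nhdsin pr_topology U)"
  proof (cases "fixed_data U (range_dist U) P")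
    case True
    then obtain y where y: "\<forall>(c, s)\<in>P. \<bar>dist (U y) c - kat (saturate U P) c\<bar> < e"
      using near by (auto simp: fixed_near_def)
    have "eventually (\<lambda>R. \<forall>p\<in>P. \<bar>dist (R y) (fst p) - kat (saturate R P) (fst p)\<bar> < e)
      (nhdsin pr_topology U)"
    proof (rule eventually_ball_finite[OF assms], rule ballI)
      fix p assume p: "p \<in> P"
      then have "((\<lambda>R. \<bar>dist (R y) (fst p) - kat (saturate R P) (fst p)\<bar>) \<longlongrightarrow>
          \<bar>dist (U y) (fst p) - kat (saturate U P) (fst p)\<bar>) (nhdsin pr_topology U)"
        by (intro tendsto_intros lim tendsto_kat_saturate U assms) auto
      then show "eventually (\<lambda>R. \<bar>dist (R y) (fst p) - kat (saturate R P) (fst p)\<bar> < e)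
          (nhdsin pr_topology U)"
        by (rule order_tendstoD) (use y p in auto)
    qed
    then show ?thesis
      by (rule eventually_mono) (auto simp: fixed_near_def case_prod_unfold)
  next
    case False
    \<comment> \<open>Distances between a centre and an image occur in both orders in
      \<open>katetov (saturate R P)\<close>; by symmetry one order suffices.\<close>
    have iff: "fixed_data R D P \<longleftrightarrow> (\<forall>p\<in>P. \<forall>q\<in>P. dist (fst p) (fst q) \<le> snd p + snd q \<and>
        dist (R (fst p)) (fst q) \<le> snd p + snd q \<and> dist (R (fst p)) (R (fst q)) \<le> snd p + snd q) \<and>
        (\<forall>p\<in>P. D (fst p) \<le> snd p)" for R D
    proof -
      have "(\<forall>p\<in>P. \<forall>q\<in>P. dist (fst p) (R (fst q)) \<le> snd p + snd q) \<longleftrightarrow>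
          (\<forall>p\<in>P. \<forall>q\<in>P. dist (R (fst p)) (fst q) \<le> snd p + snd q)"
        by (metis add.commute dist_commute)
      then show ?thesis
        unfolding fixed_data_def katetov_def saturate_def
        by (auto simp: ball_Un case_prod_unfold ball_conj_distrib)
    qed
    from False consider p q where "p \<in> P" "q \<in> P" "snd p + snd q < dist (fst p) (fst q)"
      | p q where "p \<in> P" "q \<in> P" "snd p + snd q < dist (U (fst p)) (fst q)"
      | p q where "p \<in> P" "q \<in> P" "snd p + snd q < dist (U (fst p)) (U (fst q))"
      | p where "p \<in> P" "snd p < range_dist U (fst p)"
      unfolding iff by (auto simp: not_le)
    then have "eventually (\<lambda>R. \<not> fixed_data R (range_dist R) P) (nhdsin pr_topology U)"
    proof cases
      case 1
      then show ?thesis unfolding iff by (intro always_eventually) (auto simp: not_le intro!: bexI)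
    next
      case (2 p q)
      have "eventually (\<lambda>R. snd p + snd q < dist (R (fst p)) (fst q)) (nhdsin pr_topology U)"
        by (rule order_tendstoD(1)[OF tendsto_dist[OF lim(1) tendsto_const] 2(3)])
      then show ?thesis by (rule eventually_mono) (use 2 in \<open>auto simp: iff not_le\<close>)
    next
      case (3 p q)
      have "eventually (\<lambda>R. snd p + snd q < dist (R (fst p)) (R (fst q))) (nhdsin pr_topology U)"
        by (rule order_tendstoD(1)[OF tendsto_dist[OF lim(1) lim(1)] 3(3)])
      then show ?thesis by (rule eventually_mono) (use 3 in \<open>auto simp: iff not_le\<close>)
    next
      case (4 p)
      have "eventually (\<lambda>R. snd p < range_dist R (fst p)) (nhdsin pr_topology U)"
        by (rule order_tendstoD(1)[OF lim(2) 4(2)])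
      then show ?thesis by (rule eventually_mono) (use 4 in \<open>auto simp: iff not_le\<close>)
    qed
    then show ?thesis by (rule eventually_mono) (simp add: fixed_near_def)
  qed
qed

lemma openin_moved_near:
  assumes "finite P"
  shows "openin pr_topology {U \<in> retractions. moved_near U e P b \<delta>}"
proof (rule openin_pr_topologyI)
  fix U :: "'a \<Rightarrow> 'a" assume U: "U \<in> retractions" and near: "moved_near U e P b \<delta>"
  note lim = tendsto_pr[OF U]
  show "eventually (\<lambda>U. moved_near U e P b \<delta>) (nhdsin pr_topology U)"
  proof (cases "moved_data U (range_dist U) P b \<delta>")
    case True
    then obtain y where y: "dist (U y) (U b) < e" "\<bar>range_dist U y - \<delta>\<bar> < e"
      "\<forall>(c, s)\<in>P. \<bar>dist y c - kat (insert (U b, 2 * \<delta>) P) c\<bar> < e"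
      using near by (auto simp: moved_near_def)
    have "eventually (\<lambda>R. \<forall>p\<in>P. \<bar>dist y (fst p) - kat (insert (R b, 2 * \<delta>) P) (fst p)\<bar> < e)
      (nhdsin pr_topology U)"
    proof (rule eventually_ball_finite[OF assms], rule ballI)
      fix p assume p: "p \<in> P"
      then have eq: "kat (insert (R b, 2 * \<delta>) P) x = min (2 * \<delta> + dist (R b) x) (kat P x)" for R x
        using assms by (intro kat_insert) auto
      have "((\<lambda>R. \<bar>dist y (fst p) - kat (insert (R b, 2 * \<delta>) P) (fst p)\<bar>) \<longlongrightarrow>
          \<bar>dist y (fst p) - kat (insert (U b, 2 * \<delta>) P) (fst p)\<bar>) (nhdsin pr_topology U)"
        unfolding eq by (intro tendsto_intros tendsto_min lim)
      then show "eventually (\<lambda>R. \<bar>dist y (fst p) - kat (insert (R b, 2 * \<delta>) P) (fst p)\<bar> < e)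
          (nhdsin pr_topology U)"
        by (rule order_tendstoD) (use y p in auto)
    qed
    moreover have "eventually (\<lambda>R. dist (R y) (R b) < e) (nhdsin pr_topology U)"
      by (rule order_tendstoD(2)[OF tendsto_dist[OF lim(1) lim(1)] y(1)])
    moreover have "((\<lambda>R. \<bar>range_dist R y - \<delta>\<bar>) \<longlongrightarrow> \<bar>range_dist U y - \<delta>\<bar>) (nhdsin pr_topology U)"
      by (intro tendsto_intros lim)
    then have "eventually (\<lambda>R. \<bar>range_dist R y - \<delta>\<bar> < e) (nhdsin pr_topology U)"
      by (rule order_tendstoD(2)) (rule y(2))
    ultimately show ?thesis
      by eventually_elim (auto simp: moved_near_def case_prod_unfold)
  next
    case False
    \<comment> \<open>The condition \<open>0 \<le> \<delta>\<close> comes from comparing the entry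
      \<open>(R b, 2 * \<delta>)\<close> with itself.\<close>
    have iff: "moved_data R D P b \<delta> \<longleftrightarrow> (\<forall>p\<in>P. \<forall>q\<in>P. dist (fst p) (fst q) \<le> snd p + snd q) \<and> 0 \<le> \<delta> \<and>
        (\<forall>p\<in>P. dist (R b) (fst p) \<le> 2 * \<delta> + snd p \<and> dist (R b) (R (fst p)) \<le> snd p \<and>
          \<bar>\<delta> - D (fst p)\<bar> \<le> snd p)" for R D
      unfolding moved_data_def katetov_def
      by (auto simp: case_prod_unfold dist_commute add.commute)
    from False consider "\<delta> < 0 \<or> (\<exists>p\<in>P. \<exists>q\<in>P. snd p + snd q < dist (fst p) (fst q))"
      | p where "p \<in> P" "2 * \<delta> + snd p < dist (U b) (fst p)"
      | p where "p \<in> P" "snd p < dist (U b) (U (fst p))"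
      | p where "p \<in> P" "snd p < \<bar>\<delta> - range_dist U (fst p)\<bar>"
      unfolding iff by (force simp: not_le)
    then have "eventually (\<lambda>R. \<not> moved_data R (range_dist R) P b \<delta>) (nhdsin pr_topology U)"
    proof cases
      case 1
      then show ?thesis unfolding iff by (intro always_eventually) (auto simp: not_le)
    next
      case (2 p)
      have "eventually (\<lambda>R. 2 * \<delta> + snd p < dist (R b) (fst p)) (nhdsin pr_topology U)"
        by (rule order_tendstoD(1)[OF tendsto_dist[OF lim(1) tendsto_const] 2(2)])
      then show ?thesis by (rule eventually_mono) (use 2 in \<open>auto simp: iff not_le\<close>)
    next
      case (3 p)
      have "eventually (\<lambda>R. snd p < dist (R b) (R (fst p))) (nhdsin pr_topology U)"
        by (rule order_tendstoD(1)[OF tendsto_dist[OF lim(1) lim(1)] 3(2)])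
      then show ?thesis by (rule eventually_mono) (use 3 in \<open>auto simp: iff not_le\<close>)
    next
      case (4 p)
      have "((\<lambda>R. \<bar>\<delta> - range_dist R (fst p)\<bar>) \<longlongrightarrow> \<bar>\<delta> - range_dist U (fst p)\<bar>) (nhdsin pr_topology U)"
        by (intro tendsto_intros lim)
      then have "eventually (\<lambda>R. snd p < \<bar>\<delta> - range_dist R (fst p)\<bar>) (nhdsin pr_topology U)"
        by (rule order_tendstoD(1)) (rule 4(2))
      then show ?thesis by (rule eventually_mono) (use 4 in \<open>auto simp: iff not_le\<close>)
    qed
    then show ?thesis by (rule eventually_mono) (simp add: moved_near_def)
  qed
qed

text \<open>Both conditions weaken as the tolerance grows, so the tolerances
  \<open>1 / (n + 1)\<close> represent all of them and countably many open sets remain.\<close>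

lemma gdelta_in_near_extension_property:
  assumes "countable C"
  shows "gdelta_in pr_topology {U \<in> retractions. near_extension_property C U}"
proof -
  define T where "T = (UNIV :: nat set) \<times> rational_data C \<times> C \<times> (\<rat> :: real set)"
  define e where "e n = inverse (real (Suc n))" for n
  \<comment> \<open>With \<open>retractions\<close> as a member, the family is visibly nonempty and
    its intersection consists of retractions.\<close>
  define \<O> where "\<O> = insert retractions
    ((\<lambda>(n, P). {U \<in> retractions. fixed_near U (e n) P}) ` (UNIV \<times> rational_data C) \<union>
     (\<lambda>(n, P, b, \<delta>). {U \<in> retractions. moved_near U (e n) P b \<delta>}) ` T)"
  have fin: "finite P" if "P \<in> rational_data C" for P using that by (simp add: rational_data_def)
  have mono: "\<exists>n. e n < r" if "r > 0" for r
    unfolding e_def using reals_Archimedean[OF that] by blast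
  have F: "fixed_near U r P" if "fixed_near U r' P" "r' < r" for U r r' P
    using that unfolding fixed_near_def case_prod_unfold by (meson less_trans)
  have M: "moved_near U r P b \<delta>" if "moved_near U r' P b \<delta>" "r' < r" for U r r' P b \<delta>
    using that unfolding moved_near_def case_prod_unfold by (meson less_trans)
  have "{U \<in> retractions. near_extension_property C U} = \<Inter>\<O>"
  proof
    show "{U \<in> retractions. near_extension_property C U} \<subseteq> \<Inter>\<O>"
      by (auto simp: \<O>_def T_def near_extension_property_def e_def)
    show "\<Inter>\<O> \<subseteq> {U \<in> retractions. near_extension_property C U}"
    proof
      fix U assume U: "U \<in> \<Inter>\<O>"
      have "fixed_near U (e n) P" if "P \<in> rational_data C" for n P
      proof -
        have "{U \<in> retractions. fixed_near U (e n) P} \<in> \<O>"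
          unfolding \<O>_def using that by (intro insertI2 UnI1 image_eqI[of _ _ "(n, P)"]) auto
        with U show ?thesis by blast
      qed
      moreover have "moved_near U (e n) P b \<delta>" if "P \<in> rational_data C" "b \<in> C" "\<delta> \<in> \<rat>" for n P b \<delta>
      proof -
        have "{U \<in> retractions. moved_near U (e n) P b \<delta>} \<in> \<O>"
          unfolding \<O>_def T_def using that by (intro insertI2 UnI2 image_eqI[of _ _ "(n, P, b, \<delta>)"]) auto
        with U show ?thesis by blast
      qed
      ultimately have "near_extension_property C U"
        unfolding near_extension_property_def using mono F M by meson
      then show "U \<in> {U \<in> retractions. near_extension_property C U}" using U by (simp add: \<O>_def)
    qed
  qed
  moreover have "countable \<O>"
    unfolding \<O>_def T_def using countable_rational_data[OF assms] assms by (simp add: countable_rat)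
  moreover have "openin pr_topology S" if "S \<in> \<O>" for S
    using that openin_topspace[of pr_topology] unfolding topspace_pr_topology
    by (auto simp: \<O>_def T_def intro!: openin_fixed_near openin_moved_near fin)
  moreover have "\<O> \<noteq> {}" by (simp add: \<O>_def)
  ultimately show ?thesis
    using gdelta_in_Inter[of \<O> pr_topology] open_imp_gdelta_in by metis
qed

theorem theorem1p4:
  assumes "urysohn_space TYPE('u::polish_space)"
  shows "gdelta_in pr_topology (universal_ultrahomogeneous_retractions :: ('u \<Rightarrow> 'u) set) \<and>
    pr_topology closure_of (universal_ultrahomogeneous_retractions :: ('u \<Rightarrow> 'u) set)
      = (retractions :: ('u \<Rightarrow> 'u) set)"
proof -
  obtain C :: "'u set" where C: "countable C" "\<And>X. open X \<Longrightarrow> X \<noteq> {} \<Longrightarrow> \<exists>d\<in>C. d \<in> X"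
    using countable_dense_setE by blast
  have EP: "extension_property U" if "U \<in> retractions" "near_extension_property C U" for U
    using near_extension_property_imp_extension_property[OF C(2) that] by blast
  \<comment> \<open>A generic extension of the empty structure provides \<open>W\<close>: the
    comparison argument needs one retraction already known to have the extension property.\<close>
  have "retraction_structure {} dist R D" for R :: "'u \<Rightarrow> 'u" and D
    using Metric_space_dist[of "{}"] by (simp add: retraction_structure_def retraction_structure_axioms_def)
  then obtain W :: "'u \<Rightarrow> 'u" where W: "W \<in> retractions" "near_extension_property C W"
    using generic_retraction[OF assms C finite.emptyI] by metis
  have eq: "universal_ultrahomogeneous_retractions = {U \<in> retractions. near_extension_property C U}"
  proof (intro set_eqI iffI)
    fix U :: "'u \<Rightarrow> 'u"
    assume "U \<in> universal_ultrahomogeneous_retractions"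
    then have U: "U \<in> retractions" "universal_retraction U" "ultrahomogeneous_retraction U"
      by (auto simp: universal_ultrahomogeneous_retractions_def)
    have EU: "extension_property U"
      by (rule universal_ultrahomogeneous_imp_extension_property[OF U W(1) EP[OF W]])
    have "fixed_near U e P \<and> (\<forall>b\<in>C. \<forall>\<delta>\<in>\<rat>. moved_near U e P b \<delta>)"
      if e: "e > 0" and P: "P \<in> rational_data C" for e P
    proof -
      have "finite P" using P by (simp add: rational_data_def)
      then have "fixed_realised UNIV U (range_dist U) P" "moved_realised UNIV U (range_dist U) P b \<delta>" for b \<delta>
        using EU by (simp_all add: extension_property_def)
      then show ?thesis
        using fixed_realised_imp_near[OF _ e] moved_realised_imp_near[OF _ e] by blast
    qed
    then show "U \<in> {U \<in> retractions. near_extension_property C U}"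
      using U(1) by (simp add: near_extension_property_def)
  next
    fix U :: "'u \<Rightarrow> 'u"
    assume "U \<in> {U \<in> retractions. near_extension_property C U}"
    then have U: "U \<in> retractions" "extension_property U" using EP[of U] by auto
    then show "U \<in> universal_ultrahomogeneous_retractions"
      using extension_property_imp_universal[OF U] extension_property_imp_ultrahomogeneous[OF U]
      by (simp add: universal_ultrahomogeneous_retractions_def)
  qed
  have "retractions \<subseteq> pr_topology closure_of (universal_ultrahomogeneous_retractions :: ('u \<Rightarrow> 'u) set)"
  proof
    fix R :: "'u \<Rightarrow> 'u" assume R: "R \<in> retractions"
    interpret retraction_structure UNIV dist R "range_dist R"
      by (rule retraction_structure_UNIV) fact
    show "R \<in> pr_topology closure_of universal_ultrahomogeneous_retractions"
      unfolding in_closure_of topspace_pr_topology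
    proof (intro conjI allI impI R)
      fix T assume T: "R \<in> T \<and> openin pr_topology T"
      then obtain X e where X: "finite X" "e > 0" "pr_nhd R X e \<subseteq> T"
        unfolding openin_pr_topology by blast
      \<comment> \<open>A finite structure must be closed under \<open>R\<close>, and one
        application of \<open>R\<close> achieves this. The values of \<open>D\<close> are taken from
        the whole space, not from the finite set.\<close>
      let ?A = "X \<union> R ` X"
      have "retraction_structure ?A dist R (range_dist R)"
        by (rule retraction_structure_subset[OF retraction_structure_UNIV[OF R]]) (use R_idem in auto)
      moreover have "finite ?A" using X(1) by simp
      ultimately obtain V where V: "V \<in> retractions" "near_extension_property C V"
        "\<And>x. x \<in> ?A \<Longrightarrow> V x = R x \<and> range_dist V x = range_dist R x"
        using generic_retraction[OF assms C] by metis
      \<comment> \<open>On \<open>X\<close> both the retractions and the distances to their ranges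
        agree exactly, so any positive \<open>e\<close> is met.\<close>
      have "V \<in> pr_nhd R X e" using V(1,3) X(2) by (auto simp: pr_nhd_def)
      then show "\<exists>V. V \<in> universal_ultrahomogeneous_retractions \<and> V \<in> T"
        using V(1,2) X(3) eq by blast
    qed
  qed
  moreover have "pr_topology closure_of (universal_ultrahomogeneous_retractions :: ('u \<Rightarrow> 'u) set) \<subseteq> retractions"
    using closure_of_subset_topspace[of pr_topology] by (simp add: topspace_pr_topology)
  ultimately show ?thesis
    using gdelta_in_near_extension_property[OF C(1)] by (auto simp: eq)
qed

end
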